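(* Let $A(z)$ and $B(z)$ be entire functions and let $f$ be a solution of $$f''+A(z)f'+B(z)f=0.$$ Suppose that $f$ and $A$ are transcendental exponential polynomials and that $B$ satisfies $T(r,B)=o(T(r,A))$ as $r\to\infty$. Then: (a) $f$ and $A$ are dual exponential polynomials of some common order $q\in\mathbb{N}$; $f$ has a normalized representation of the form $$f(z)=c+F_1(z)e^{w_1z^q}+\cdots+F_m(z)e^{w_mz^q},$$ where $m\in\mathbb{N}$, $c\in\mathbb{C}\setminus\{0\}$, the $w_j$ are non-zero and pairwise distinct, and the $F_j\not\equiv 0$ are exponential polynomials of order $\le q-1$; and $B$ is an exponential polynomial of order $\rho(B)\le q-1$. (b) The non-zero frequencies of $f$ are commensurable if and only if the non-zero frequencies of $A$ are commensurable. In both cases, $f$ and $A$ are strongly dual exponential polynomials.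
   Context: An exponential polynomial is a function $f(z)=P_1(z)e^{Q_1(z)}+\cdots+P_k(z)e^{Q_k(z)}$ with polynomials $P_j,Q_j$; polynomials are exponential polynomials of order $0$. A transcendental exponential polynomial $f$ can be written uniquely in the normalized form $f(z)=F_0(z)+F_1(z)e^{w_1z^q}+\cdots+F_m(z)e^{w_mz^q}$, where $q=\max_j \deg Q_j\ge 1$ equals the order $\rho(f)$ of $f$, the (non-zero) frequencies $w_1,\dots,w_m$ are non-zero and pairwise distinct complex numbers, and the multipliers $F_j$ are exponential polynomials of order $\le q-1$ with $F_j\not\equiv0$ for $1\le j\le m$ ($F_0$ may vanish). $f$ is called simple if all its non-zero frequencies lie on one ray $\arg w=\theta$. Two simple exponential polynomials $f,g$ of the same order $q$ are dual if the non-zero frequencies of $f$ lie on a ray $\arg w=\theta$ and those of $g$ on the opposite ray $\arg w=\theta+\pi$. The non-zero frequencies $w_1,\dots,w_m$ of a simple exponential polynomial are commensurable if there is $w\in\mathbb{C}\setminus\{0\}$ (a common factor) with $w_j/w$ a positive integer for every $j$. Dual exponential polynomials $f$ and $g$ with non-zero frequencies $\{w_j\}$ and $\{\lambda_i\}$ are strongly dual if both sets of frequencies are commensurable, with common factor $w$ for $\{w_j\}$ and common factor $-w$ for $\{\lambda_i\}$ for the same $w$, and all the points $w_j+\lambda_i$ (over all $i,j$) lie on a single ray emanating from the origin (the origin included). $T(r,\cdot)$ denotes the Nevanlinna characteristic function. *)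

theory Defs
  imports "HOL-Analysis.Analysis" "HOL-Computational_Algebra.Polynomial" "HOL-Library.Landau_Symbols"
begin

definition exp_poly :: "(complex \<Rightarrow> complex) \<Rightarrow> bool" where
  "exp_poly f \<longleftrightarrow> (\<exists>ps :: (complex poly \<times> complex poly) list.
      \<forall>z. f z = (\<Sum>(P, Q)\<leftarrow>ps. poly P z * exp (poly Q z)))"

definition transcendental_fun :: "(complex \<Rightarrow> complex) \<Rightarrow> bool" where
  "transcendental_fun f \<longleftrightarrow> \<not> (\<exists>p. \<forall>z. f z = poly p z)"

definition max_mod :: "(complex \<Rightarrow> complex) \<Rightarrow> real \<Rightarrow> real" where
  "max_mod f r = Sup ((\<lambda>z. cmod (f z)) ` sphere 0 r)"

definition entire_order :: "(complex \<Rightarrow> complex) \<Rightarrow> ereal" where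
  "entire_order f = Limsup at_top
     (\<lambda>r::real. ereal (ln (max 1 (ln (max 1 (max_mod f r)))) / ln r))"

text \<open>Nevanlinna characteristic; for entire functions N(r,f)=0, so T(r,f)=m(r,f).\<close>
definition nev_T :: "(complex \<Rightarrow> complex) \<Rightarrow> real \<Rightarrow> real" where
  "nev_T f r = (1 / (2 * pi)) *
     integral {0..2*pi} (\<lambda>t. max 0 (ln (cmod (f (complex_of_real r * exp (\<i> * complex_of_real t))))))"

definition normalized_rep ::
  "nat \<Rightarrow> (complex \<Rightarrow> complex) \<Rightarrow> (complex \<Rightarrow> complex) \<Rightarrow> complex set
     \<Rightarrow> (complex \<Rightarrow> complex \<Rightarrow> complex) \<Rightarrow> bool" where
  "normalized_rep q f F0 W F \<longleftrightarrow>
     q \<ge> 1 \<and> finite W \<and> W \<noteq> {} \<and> 0 \<notin> W \<and>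
     exp_poly F0 \<and> entire_order F0 \<le> ereal (real q - 1) \<and>
     (\<forall>w\<in>W. exp_poly (F w) \<and> entire_order (F w) \<le> ereal (real q - 1) \<and> F w \<noteq> (\<lambda>_. 0)) \<and>
     (\<forall>z. f z = F0 z + (\<Sum>w\<in>W. F w z * exp (w * z ^ q)))"

definition dual_freqs :: "complex set \<Rightarrow> complex set \<Rightarrow> bool" where
  "dual_freqs W L \<longleftrightarrow> (\<exists>u. cmod u = 1 \<and>
     (\<forall>w\<in>W. \<exists>t>0. w = complex_of_real t * u) \<and>
     (\<forall>l\<in>L. \<exists>t>0. l = complex_of_real t * (- u)))"

definition commensurable :: "complex set \<Rightarrow> bool" where
  "commensurable W \<longleftrightarrow> (\<exists>c. c \<noteq> 0 \<and> (\<forall>w\<in>W. \<exists>n::nat. n > 0 \<and> w = of_nat n * c))"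

definition strongly_dual_freqs :: "complex set \<Rightarrow> complex set \<Rightarrow> bool" where
  "strongly_dual_freqs W L \<longleftrightarrow> dual_freqs W L \<and>
     (\<exists>c. c \<noteq> 0 \<and> (\<forall>w\<in>W. \<exists>n::nat. n > 0 \<and> w = of_nat n * c) \<and>
          (\<forall>l\<in>L. \<exists>n::nat. n > 0 \<and> l = of_nat n * (- c))) \<and>
     (\<exists>u. u \<noteq> 0 \<and> (\<forall>w\<in>W. \<forall>l\<in>L. \<exists>t\<ge>0. w + l = complex_of_real t * u))"

end

(* Let s be the order of A. Since T(r,B) = o(T(r,A)), the entire function B has growth exp(o(|z|^s)).
   Entire functions of this growth form a differential ring, and the exponentials of distinct
   polynomials without monomials of degree below s are linearly independent over it. Hence the
   differential equation can be compared coefficientwise after expanding A and f in such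
   exponentials. Order the frequencies by a direction in which A has a positive frequency: the
   product of the largest terms of A and f' can only cancel against B times a constant term of f.
   So f has a non-zero constant term c, the largest frequency of f' is minus the largest frequency
   of A, and B is -1/c times the product of the two corresponding coefficients. Varying the
   direction gives duality; restricting the equation to the lattice generated by the common factor
   gives the statement on commensurability. *)
theory Submission
  imports Defs "HOL-Complex_Analysis.Complex_Analysis" "HOL-Real_Asymp.Real_Asymp"
begin

section \<open>Linear independence of exponentials\<close>

text \<open>The scale \<open>s\<close> has to come from \<open>A\<close> alone: the order of
  \<open>f\<close> is not known beforehand, and its exponents might have degree above
  \<open>s\<close>. So \<open>f\<close> is expanded over arbitrary polynomials without monomials
  below degree \<open>s\<close>, and only the extremal argument shows that all of them have the form
  w z^s. Likewise \<open>B\<close> enters as one more coefficient of unknown form. The hypothesis on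
  \<open>B\<close> concerns circle means, whereas independence needs pointwise bounds. Passing from
  means to points costs a constant factor and a doubling of the radius; the little-o absorbs both,
  because A = exp(O(|z|^s)). The two halves of the equivalence on commensurability differ in method.
  From \<open>f\<close> to \<open>A\<close>, a frequency of \<open>A\<close> off the lattice yields
  a product that nothing can cancel. From \<open>A\<close> to \<open>f\<close>, the equation splits
  along the lattice. The ray in strong duality is a by-product of extremality: the largest frequency
  of \<open>A\<close> is opposite to the frequency of \<open>f\<close> nearest to the origin, so
  each sum of two frequencies is 0 or lies on the side of \<open>f\<close>.\<close>

definition small_growth :: "nat \<Rightarrow> (complex \<Rightarrow> complex) \<Rightarrow> bool" where
  "small_growth s g \<longleftrightarrow> g holomorphic_on UNIV \<and>
     (\<forall>e>0. \<forall>\<^sub>F z in at_infinity. cmod (g z) \<le> exp (e * cmod z ^ s))"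

text \<open>The possible exponents once everything of degree below \<open>s\<close> is absorbed in the coefficients.\<close>

definition high_poly :: "nat \<Rightarrow> complex poly \<Rightarrow> bool" where
  "high_poly s T \<longleftrightarrow> (\<forall>i<s. coeff T i = 0)"

lemma small_growthD: "small_growth s g \<Longrightarrow> e > 0 \<Longrightarrow>
    \<forall>\<^sub>F z in at_infinity. cmod (g z) \<le> exp (e * cmod z ^ s)"
  by (simp add: small_growth_def)

lemma small_growth_holomorphic: "small_growth s g \<Longrightarrow> g holomorphic_on UNIV"
  by (simp add: small_growth_def)

section \<open>The ring of entire functions of growth exp(o(|z|^s))\<close>

lemma eventually_norm_ge: "\<forall>\<^sub>F z in at_infinity. b \<le> cmod z"
  by (auto simp: eventually_at_infinity)

lemma eventually_norm_power_ge:
  assumes "s > 0" "e > 0"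
  shows "\<forall>\<^sub>F z in at_infinity. b \<le> e * cmod z ^ s"
proof -
  have "\<forall>\<^sub>F z in at_infinity. max 1 (b / e) \<le> cmod z"
    by (rule eventually_norm_ge)
  then show ?thesis
  proof eventually_elim
    case (elim z)
    then have "b / e \<le> cmod z" "1 \<le> cmod z" by auto
    moreover have "cmod z \<le> cmod z ^ s"
      using self_le_power[of "cmod z" s] assms(1) calculation(2) by simp
    ultimately have "b / e \<le> cmod z ^ s" by linarith
    then show ?case using assms(2) by (simp add: field_simps)
  qed
qed

lemma small_growth_mono:
  assumes "small_growth s g" "s \<le> d"
  shows "small_growth d g"
  unfolding small_growth_def
proof (intro conjI allI impI)
  show "g holomorphic_on UNIV" using assms by (simp add: small_growth_def)
  fix e :: real assume e: "e > 0"
  show "\<forall>\<^sub>F z in at_infinity. cmod (g z) \<le> exp (e * cmod z ^ d)"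
    using small_growthD[OF assms(1) e] eventually_norm_ge[of 1]
  proof eventually_elim
    case (elim z)
    have "cmod z ^ s \<le> cmod z ^ d" using elim(2) assms(2) by (rule power_increasing[rotated])
    then have "exp (e * cmod z ^ s) \<le> exp (e * cmod z ^ d)" using e by simp
    then show ?case using elim(1) by linarith
  qed
qed

lemma small_growth_mult:
  assumes "small_growth s g" "small_growth s h"
  shows "small_growth s (\<lambda>z. g z * h z)"
  unfolding small_growth_def
proof (intro conjI allI impI)
  show "(\<lambda>z. g z * h z) holomorphic_on UNIV"
    using assms by (auto simp: small_growth_def intro!: holomorphic_intros)
  fix e :: real assume e: "e > 0"
  then have e2: "e / 2 > 0" by simp
  show "\<forall>\<^sub>F z in at_infinity. cmod (g z * h z) \<le> exp (e * cmod z ^ s)"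
    using small_growthD[OF assms(1) e2] small_growthD[OF assms(2) e2]
  proof eventually_elim
    case (elim z)
    have "cmod (g z * h z) \<le> exp (e/2 * cmod z ^ s) * exp (e/2 * cmod z ^ s)"
      unfolding norm_mult using elim by (intro mult_mono) auto
    also have "\<dots> = exp (e * cmod z ^ s)" by (simp flip: exp_add)
    finally show ?case .
  qed
qed

lemma small_growth_add:
  assumes "s > 0" "small_growth s g" "small_growth s h"
  shows "small_growth s (\<lambda>z. g z + h z)"
  unfolding small_growth_def
proof (intro conjI allI impI)
  show "(\<lambda>z. g z + h z) holomorphic_on UNIV"
    using assms by (auto simp: small_growth_def intro!: holomorphic_intros)
  fix e :: real assume e: "e > 0"
  then have e2: "e / 2 > 0" by simp
  show "\<forall>\<^sub>F z in at_infinity. cmod (g z + h z) \<le> exp (e * cmod z ^ s)"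
    using small_growthD[OF assms(2) e2] small_growthD[OF assms(3) e2]
      eventually_norm_power_ge[OF assms(1) e2, of "ln 2"]
  proof eventually_elim
    case (elim z)
    have "cmod (g z + h z) \<le> 2 * exp (e/2 * cmod z ^ s)"
      using norm_triangle_ineq[of "g z" "h z"] elim by linarith
    also have "\<dots> = exp (ln 2) * exp (e/2 * cmod z ^ s)" by simp
    also have "\<dots> \<le> exp (e/2 * cmod z ^ s) * exp (e/2 * cmod z ^ s)"
      using elim(3) by (intro mult_right_mono) (auto simp del: exp_ln)
    also have "\<dots> = exp (e * cmod z ^ s)" by (simp flip: exp_add)
    finally show ?case .
  qed
qed

lemma small_growth_const:
  assumes "s > 0"
  shows "small_growth s (\<lambda>_. c)"
  unfolding small_growth_def
proof (intro conjI allI impI)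
  fix e :: real assume e: "e > 0"
  show "\<forall>\<^sub>F z in at_infinity. cmod c \<le> exp (e * cmod z ^ s)"
    using eventually_norm_power_ge[OF assms e, of "cmod c"]
    by eventually_elim (smt (verit) exp_ge_add_one_self)
qed auto

lemma small_growth_cmult: "s > 0 \<Longrightarrow> small_growth s g \<Longrightarrow> small_growth s (\<lambda>z. c * g z)"
  by (intro small_growth_mult small_growth_const)

lemma small_growth_diff:
  assumes "s > 0" "small_growth s g" "small_growth s h"
  shows "small_growth s (\<lambda>z. g z - h z)"
  using small_growth_add[OF assms(1,2) small_growth_cmult[OF assms(1,3), of "-1"]] by simp

lemma small_growth_sum:
  assumes "s > 0" "\<And>i. i \<in> I \<Longrightarrow> small_growth s (g i)"
  shows "small_growth s (\<lambda>z. \<Sum>i\<in>I. g i z)"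
  using assms(2)
  by (induction I rule: infinite_finite_induct)
     (auto intro!: small_growth_add small_growth_const assms(1))

lemma small_growth_id:
  assumes "s > 0"
  shows "small_growth s (\<lambda>z. z)"
  unfolding small_growth_def
proof (intro conjI allI impI)
  fix e :: real assume e: "e > 0"
  have "eventually (\<lambda>r::real. r \<le> exp (e * r)) at_top" using e by real_asymp
  then obtain b where b: "\<And>r. r \<ge> b \<Longrightarrow> r \<le> exp (e * r)"
    by (auto simp: eventually_at_top_linorder)
  show "\<forall>\<^sub>F z in at_infinity. cmod z \<le> exp (e * cmod z ^ s)"
    using eventually_norm_ge[of b] eventually_norm_ge[of 1]
  proof eventually_elim
    case (elim z)
    have "cmod z \<le> cmod z ^ s" using elim(2) assms by (simp add: self_le_power)
    then have "exp (e * cmod z) \<le> exp (e * cmod z ^ s)" using e by simp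
    then show ?case using b[OF elim(1)] by linarith
  qed
qed auto

lemma small_growth_poly: "s > 0 \<Longrightarrow> small_growth s (poly P)"
proof (induction P)
  case 0
  then show ?case using small_growth_const[of s 0] by (simp add: fun_eq_iff[symmetric])
next
  case (pCons a p)
  have "poly (pCons a p) = (\<lambda>z. a + z * poly p z)" by auto
  then show ?case
    using pCons by (auto intro!: small_growth_add small_growth_mult small_growth_const small_growth_id)
qed

lemma poly_norm_bound:
  fixes P :: "complex poly"
  obtains K where "K \<ge> 0" "\<And>z. cmod z \<ge> 1 \<Longrightarrow> cmod (poly P z) \<le> K * cmod z ^ degree P"
proof
  show "(\<Sum>i\<le>degree P. cmod (coeff P i)) \<ge> 0" by (simp add: sum_nonneg)
  fix z :: complex assume z: "cmod z \<ge> 1"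
  have "cmod (poly P z) \<le> (\<Sum>i\<le>degree P. cmod (coeff P i) * cmod z ^ i)"
    unfolding poly_altdef by (rule order_trans[OF norm_sum]) (simp add: norm_mult norm_power)
  also have "\<dots> \<le> (\<Sum>i\<le>degree P. cmod (coeff P i) * cmod z ^ degree P)"
    using z by (intro sum_mono mult_left_mono power_increasing) auto
  finally show "cmod (poly P z) \<le> (\<Sum>i\<le>degree P. cmod (coeff P i)) * cmod z ^ degree P"
    by (simp add: sum_distrib_right)
qed

lemma poly_lower_degree_bound:
  fixes P :: "complex poly"
  assumes "degree P < s" "e > 0"
  shows "\<forall>\<^sub>F z in at_infinity. cmod (poly P z) \<le> e * cmod z ^ s"
proof -
  obtain K where K: "K \<ge> 0" "\<And>z. cmod z \<ge> 1 \<Longrightarrow> cmod (poly P z) \<le> K * cmod z ^ degree P"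
    using poly_norm_bound[of P] by blast
  have "s - degree P > 0" using assms by simp
  show ?thesis
    using eventually_norm_ge[of 1] eventually_norm_power_ge[OF \<open>s - degree P > 0\<close> assms(2), of K]
  proof eventually_elim
    case (elim z)
    have "cmod (poly P z) \<le> (e * cmod z ^ (s - degree P)) * cmod z ^ degree P"
      using K(2)[OF elim(1)] mult_right_mono[OF elim(2), of "cmod z ^ degree P"] by simp
    also have "\<dots> = e * cmod z ^ s" using assms by (simp add: mult.assoc flip: power_add)
    finally show ?case .
  qed
qed

lemma small_growth_exp_poly:
  assumes "degree Q < s"
  shows "small_growth s (\<lambda>z. exp (poly Q z))"
  unfolding small_growth_def
proof (intro conjI allI impI)
  show "(\<lambda>z. exp (poly Q z)) holomorphic_on UNIV" by (intro holomorphic_intros)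
  fix e :: real assume e: "e > 0"
  show "\<forall>\<^sub>F z in at_infinity. cmod (exp (poly Q z)) \<le> exp (e * cmod z ^ s)"
    using poly_lower_degree_bound[OF assms e]
    by eventually_elim (use complex_Re_le_cmod order_trans in \<open>auto simp: norm_exp_eq_Re\<close>)
qed

lemma small_growth_deriv:
  assumes "small_growth s g"
  shows "small_growth s (deriv g)"
  unfolding small_growth_def
proof (intro conjI allI impI)
  have hol: "g holomorphic_on UNIV" using assms by (simp add: small_growth_def)
  then show "deriv g holomorphic_on UNIV" by (intro holomorphic_deriv) auto
  fix e :: real assume e: "e > 0"
  \<comment> \<open>Cauchy's estimate is used on the circle of radius 1 around \<open>z\<close>,
    where |x| <= 2|z|; the factor 2 ^ s compensates for this.\<close>
  then have e2: "e / 2 ^ s > 0" by simp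
  obtain b where b: "\<And>z. cmod z \<ge> b \<Longrightarrow> cmod (g z) \<le> exp (e / 2 ^ s * cmod z ^ s)"
    using small_growthD[OF assms e2] by (auto simp: eventually_at_infinity)
  show "\<forall>\<^sub>F z in at_infinity. cmod (deriv g z) \<le> exp (e * cmod z ^ s)"
    using eventually_norm_ge[of "b + 1"] eventually_norm_ge[of 1]
  proof eventually_elim
    case (elim z)
    have "cmod (g x) \<le> exp (e * cmod z ^ s)" if "cmod (z - x) = 1" for x
    proof -
      have 1: "cmod x \<ge> b" "cmod x \<le> 2 * cmod z"
        using that elim norm_triangle_ineq2[of z x] norm_triangle_ineq2[of x z]
        by (auto simp: norm_minus_commute)
      have "cmod x ^ s \<le> (2 * cmod z) ^ s" using 1 by (intro power_mono) auto
      then have "e / 2 ^ s * cmod x ^ s \<le> e / 2 ^ s * (2 * cmod z) ^ s"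
        using e2 by (intro mult_left_mono) auto
      also have "\<dots> = e * cmod z ^ s" by (simp add: power_mult_distrib)
      finally have "exp (e / 2 ^ s * cmod x ^ s) \<le> exp (e * cmod z ^ s)" by simp
      then show ?thesis using b[OF 1(1)] by linarith
    qed
    then have "cmod ((deriv ^^ 1) g z) \<le> fact 1 * exp (e * cmod z ^ s) / 1 ^ 1"
      using hol by (intro Cauchy_inequality)
        (auto intro: holomorphic_on_subset holomorphic_on_imp_continuous_on)
    then show ?case by simp
  qed
qed

section \<open>Identity theorem and absence of zero divisors\<close>

lemma entire_zero_on_ball:
  fixes g :: "complex \<Rightarrow> complex"
  assumes "g holomorphic_on UNIV" "r > 0" "\<And>z. z \<in> ball a r \<Longrightarrow> g z = 0"
  shows "g z = 0"
  using analytic_continuation_open[of "ball a r" UNIV g "\<lambda>_. 0"] assms by auto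

lemma entire_nonzero_ball:
  fixes g :: "complex \<Rightarrow> complex"
  assumes "g holomorphic_on UNIV" "g a \<noteq> 0"
  obtains r where "r > 0" "\<And>z. z \<in> ball a r \<Longrightarrow> g z \<noteq> 0"
proof -
  have "isCont g a" using holomorphic_on_imp_continuous_on[OF assms(1)]
    by (simp add: continuous_on_eq_continuous_at)
  then obtain r where "r > 0" "\<And>z. dist a z < r \<Longrightarrow> g z \<noteq> 0"
    using continuous_at_avoid[of a g 0] assms(2) by auto
  then show ?thesis using that by auto
qed

lemma entire_mult_eq_0:
  fixes g h :: "complex \<Rightarrow> complex"
  assumes "g holomorphic_on UNIV" "h holomorphic_on UNIV" "\<And>z. g z * h z = 0"
  shows "(\<forall>z. g z = 0) \<or> (\<forall>z. h z = 0)"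
proof (cases "\<forall>z. g z = 0")
  case False
  then obtain a where "g a \<noteq> 0" by blast
  then obtain r where r: "r > 0" "\<And>z. z \<in> ball a r \<Longrightarrow> g z \<noteq> 0"
    using entire_nonzero_ball[OF assms(1)] by blast
  then have "\<And>z. z \<in> ball a r \<Longrightarrow> h z = 0" using assms(3) by (metis mult_eq_0_iff)
  then show ?thesis using entire_zero_on_ball[OF assms(2) r(1)] by blast
qed auto

lemma high_poly_degree: "high_poly s T \<Longrightarrow> T \<noteq> 0 \<Longrightarrow> s \<le> degree T"
  unfolding high_poly_def by (metis leading_coeff_0_iff not_le)

lemma high_poly_add: "high_poly s T \<Longrightarrow> high_poly s S \<Longrightarrow> high_poly s (T + S)"
  and high_poly_diff: "high_poly s T \<Longrightarrow> high_poly s S \<Longrightarrow> high_poly s (T - S)"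
  and high_poly_monom: "high_poly s (monom w s)"
  and high_poly_0: "high_poly s 0"
  by (auto simp: high_poly_def)

text \<open>The four real parts are \<open>Re v\<close>, \<open>- Im v\<close>,
  \<open>- Re v\<close>, \<open>Im v\<close>, so their positive parts add up to |Re v| + |Im
  v|.\<close>

lemma abs_Re_quarter_turns:
  "(max 0 (Re v) + max 0 (Re (\<i> * v))) + (max 0 (Re (\<i>^2 * v)) + max 0 (Re (\<i>^3 * v))) \<ge> cmod v"
proof -
  have "\<i> ^ 3 = - \<i>" by (simp add: eval_nat_numeral)
  then show ?thesis using cmod_le[of v] by (auto simp: max_def abs_if split: if_splits)
qed

text \<open>With \<open>\<zeta> ^ d = \<i>\<close>, the four rotations of the leading monomial of \<open>T\<close> by powers of \<open>\<zeta>\<close> cover all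
  directions, so the product of the rotated copies of \<open>N\<close> tends to 0 everywhere and
  Liouville's theorem applies.\<close>

lemma no_exp_quotient:
  assumes s: "s > 0" and N: "small_growth s N" and D: "small_growth s D"
    and T: "high_poly s T" "T \<noteq> 0"
    and eq: "\<And>z. N z * exp (poly T z) = D z"
  shows "N z = 0"
proof -
  define d where "d = degree T"
  define w where "w = lead_coeff T"
  have w: "w \<noteq> 0" using T by (simp add: w_def)
  have d: "s \<le> d" "d > 0" using high_poly_degree[OF T] s by (auto simp: d_def)
  define R where "R = T - monom w d"
  have "degree R \<le> d - 1"
    by (rule degree_le) (auto simp: R_def w_def d_def coeff_eq_0)
  then have dR: "degree R < d" using d by simp
  have T_eq: "poly T z = w * z ^ d + poly R z" for z
    by (simp add: R_def poly_monom)
  define \<zeta> where "\<zeta> = cis (pi / (2 * real d))"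
  have "\<zeta> ^ d = cis (real d * (pi / (2 * real d)))" unfolding \<zeta>_def by (rule Complex.DeMoivre)
  also have "real d * (pi / (2 * real d)) = pi / 2" using d by simp
  finally have \<zeta>: "\<zeta> ^ d = \<i>" "cmod \<zeta> = 1" by (simp_all add: \<zeta>_def)
  \<comment> \<open>Each of the four factors will cost 2e|z|^d, in total |w||z|^d / 2; half of the
    decay |w||z|^d is left.\<close>
  define e where "e = cmod w / 16"
  have e: "e > 0" using w by (simp add: e_def)
  have "\<forall>\<^sub>F z in at_infinity. cmod (N z) \<le> exp (2 * e * cmod z ^ d - max 0 (Re (w * z ^ d)))"
    using small_growthD[OF small_growth_mono[OF N d(1)] e]
      small_growthD[OF small_growth_mono[OF D d(1)] e] poly_lower_degree_bound[OF dR e]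
  proof eventually_elim
    case (elim z)
    have nn: "e * cmod z ^ d \<ge> 0" using e by simp
    have "N z = D z * exp (- poly T z)" using eq[of z] by (simp add: exp_minus field_simps)
    then have "cmod (N z) = cmod (D z) * exp (- Re (poly T z))" by (simp add: norm_mult norm_exp_eq_Re)
    also have "\<dots> \<le> exp (e * cmod z ^ d) * exp (- Re (poly T z))"
      using elim by (intro mult_right_mono) auto
    also have "\<dots> = exp (e * cmod z ^ d - Re (w * z ^ d) - Re (poly R z))"
      by (simp add: T_eq flip: exp_add)
    also have "\<dots> \<le> exp (2 * e * cmod z ^ d - Re (w * z ^ d))"
      using elim(3) abs_Re_le_cmod[of "poly R z"] by simp
    finally have 1: "cmod (N z) \<le> exp (2 * e * cmod z ^ d - Re (w * z ^ d))" .
    \<comment> \<open>Where the exponential is small, dividing by it is useless and the growth of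
      \<open>N\<close> itself is used. The two bounds combine into the positive part of the real
      part.\<close>
    have 2: "cmod (N z) \<le> exp (2 * e * cmod z ^ d)"
      using elim(1) nn by (elim order_trans) (subst exp_le_cancel_iff, linarith)
    show ?case using 1 2 by (simp add: max_def)
  qed
  then obtain b where b: "\<And>z. cmod z \<ge> b \<Longrightarrow>
      cmod (N z) \<le> exp (2 * e * cmod z ^ d - max 0 (Re (w * z ^ d)))"
    by (auto simp: eventually_at_infinity)
  define M where "M = (\<lambda>z. (N z * N (\<zeta> * z)) * (N (\<zeta>^2 * z) * N (\<zeta>^3 * z)))"
  have holN: "N holomorphic_on UNIV" using N by (rule small_growth_holomorphic)
  have holc: "(\<lambda>z. N (c * z)) holomorphic_on UNIV" for c
    using holomorphic_on_compose[of "\<lambda>z. c * z" UNIV N] holN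
    by (auto simp: o_def intro!: holomorphic_intros intro: holomorphic_on_subset)
  have holM: "M holomorphic_on UNIV" unfolding M_def by (intro holomorphic_intros holN holc)
  have Mb: "cmod (M z) \<le> exp (- 8 * e * cmod z ^ d)" if z: "cmod z \<ge> b" for z
  proof -
    define v where "v = w * z ^ d"
    define u where "u = 2 * e * cmod z ^ d"
    have k: "cmod (N (\<zeta> ^ k * z)) \<le> exp (u - max 0 (Re (\<i> ^ k * v)))" for k
    proof -
      have "(\<zeta> ^ k) ^ d = \<i> ^ k" using \<zeta>(1) by (metis power_mult mult.commute)
      then have "w * (\<zeta> ^ k * z) ^ d = \<i> ^ k * v" by (simp add: v_def power_mult_distrib)
      then show ?thesis using b[of "\<zeta> ^ k * z"] z \<zeta>(2) by (simp add: u_def norm_mult norm_power)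
    qed
    have "cmod (M z) \<le> (exp (u - max 0 (Re v)) * exp (u - max 0 (Re (\<i> * v)))) *
        (exp (u - max 0 (Re (\<i>^2 * v))) * exp (u - max 0 (Re (\<i>^3 * v))))"
      unfolding M_def norm_mult using k[of 0] k[of 1] k[of 2] k[of 3]
      by (intro mult_mono mult_nonneg_nonneg) (simp_all add: norm_mult)
    also have "\<dots> = exp (4 * u - ((max 0 (Re v) + max 0 (Re (\<i> * v))) +
        (max 0 (Re (\<i>^2 * v)) + max 0 (Re (\<i>^3 * v)))))"
      unfolding exp_add[symmetric] by (rule arg_cong[of _ _ exp]) linarith
    also have "\<dots> \<le> exp (4 * u - cmod v)"
      using abs_Re_quarter_turns[of v] by (subst exp_le_cancel_iff) linarith
    also have "4 * u - cmod v = - 8 * e * cmod z ^ d"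
      by (simp add: u_def v_def e_def norm_mult norm_power)
    finally show ?thesis .
  qed
  have "(M \<longlongrightarrow> 0) at_infinity"
  proof (rule tendstoI)
    fix \<delta> :: real assume \<delta>: "\<delta> > 0"
    show "\<forall>\<^sub>F z in at_infinity. dist (M z) 0 < \<delta>"
      using eventually_norm_ge[of b] eventually_norm_power_ge[OF d(2) e, of "1 - ln \<delta>"]
    proof eventually_elim
      case (elim z)
      have "e * cmod z ^ d \<ge> 0" using e by simp
      then have "- 8 * e * cmod z ^ d < ln \<delta>" using elim(2) by linarith
      then have "exp (- 8 * e * cmod z ^ d) < exp (ln \<delta>)" by (subst exp_less_cancel_iff)
      also have "\<dots> = \<delta>" using \<delta> by simp
      finally show ?case using Mb[OF elim(1)] by simp
    qed
  qed
  then have "M z = 0" for z using Liouville_weak_0[OF holM] by blast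
  then have M0: "(N z * N (\<zeta> * z)) * (N (\<zeta>^2 * z) * N (\<zeta>^3 * z)) = 0" for z
    by (simp add: M_def)
  \<comment> \<open>Since the product vanishes, one of the rotated copies vanishes identically;
    rotating back recovers \<open>N\<close>.\<close>
  have "\<exists>c. c \<noteq> 0 \<and> (\<forall>z. N (c * z) = 0)"
  proof -
    have "\<zeta> \<noteq> 0" using \<zeta>(2) by auto
    have "(\<forall>z. N z * N (\<zeta> * z) = 0) \<or> (\<forall>z. N (\<zeta>^2 * z) * N (\<zeta>^3 * z) = 0)"
      by (rule entire_mult_eq_0[OF _ _ M0]; intro holomorphic_intros holN holc)
    then have "((\<forall>z. N (1 * z) = 0) \<or> (\<forall>z. N (\<zeta> * z) = 0)) \<or> ((\<forall>z. N (\<zeta>^2 * z) = 0) \<or> (\<forall>z. N (\<zeta>^3 * z) = 0))"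
      using entire_mult_eq_0[OF holc holc, of 1 \<zeta>] entire_mult_eq_0[OF holc holc, of "\<zeta>^2" "\<zeta>^3"]
      by auto
    then show ?thesis using \<open>\<zeta> \<noteq> 0\<close> by (metis power_not_zero zero_neq_one)
  qed
  then obtain c where "c \<noteq> 0" "\<And>z. N (c * z) = 0" by blast
  from this(2)[of "z / c"] this(1) show ?thesis by simp
qed

lemma exp_term_deriv:
  assumes "g holomorphic_on UNIV"
  shows "((\<lambda>z. g z * exp (poly T z)) has_field_derivative
           (deriv g z + poly (pderiv T) z * g z) * exp (poly T z)) (at z)"
proof -
  have "(g has_field_derivative deriv g z) (at z)"
    using assms by (simp add: holomorphic_derivI)
  then show ?thesis
    by (auto intro!: derivative_eq_intros poly_DERIV simp: algebra_simps)
qed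

text \<open>Induction on the set of exponents. Eliminating one term by Wronskians leaves a shorter
  relation, so the Wronskians vanish and every other term is a constant multiple of the eliminated
  one. By \<open>no_exp_quotient\<close>, applied to the difference of the exponents, these other
  terms are zero, and a relation with a single term remains.\<close>

theorem exp_independent:
  assumes s: "s > 0" and "finite U"
    and "\<And>T. T \<in> U \<Longrightarrow> high_poly s T"
    and "\<And>T. T \<in> U \<Longrightarrow> small_growth s (C T)"
    and "\<And>z. (\<Sum>T\<in>U. C T z * exp (poly T z)) = 0"
    and "T \<in> U"
  shows "C T z = 0"
  using assms(2-)
proof (induction U arbitrary: C T z rule: finite_psubset_induct)
  case (psubset U C T1 z1)
  have hol: "C T holomorphic_on UNIV" if "T \<in> U" for T
    using psubset.prems(2)[OF that] by (rule small_growth_holomorphic)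
  show ?case
  proof (rule ccontr)
    assume nz: "C T1 z1 \<noteq> 0"
    define c where "c = C T1"
    have T1: "T1 \<in> U" by fact
    have c_hol: "c holomorphic_on UNIV" and c_sg: "small_growth s c"
      using hol[OF T1] psubset.prems(2)[OF T1] by (auto simp: c_def)
    define C' where "C' = (\<lambda>T z. deriv (C T) z + poly (pderiv T) z * C T z)"
    have C'_sg: "small_growth s (C' T)" if "T \<in> U" for T
      unfolding C'_def using psubset.prems(2)[OF that]
      by (intro small_growth_add small_growth_mult small_growth_deriv small_growth_poly s)
    \<comment> \<open>The Wronskians with the term of exponent \<open>T1\<close> satisfy a shorter relation.\<close>
    define D where "D = (\<lambda>T z. C T z * C' T1 z - C' T z * c z)"
    have sum': "(\<Sum>T\<in>U. C' T z * exp (poly T z)) = 0" for z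
    proof -
      have "((\<lambda>z. \<Sum>T\<in>U. C T z * exp (poly T z)) has_field_derivative
              (\<Sum>T\<in>U. C' T z * exp (poly T z))) (at z)"
        unfolding C'_def by (intro DERIV_sum exp_term_deriv hol)
      moreover have "(\<lambda>z. \<Sum>T\<in>U. C T z * exp (poly T z)) = (\<lambda>_. 0)"
        using psubset.prems(3) by auto
      ultimately show ?thesis using DERIV_unique DERIV_const by metis
    qed
    have D0: "D T z = 0" if T: "T \<in> U - {T1}" for T z
    proof (rule psubset.IH[where C = D, OF _ _ _ _ T])
      show "U - {T1} \<subset> U" using T1 by blast
      show "high_poly s T" if "T \<in> U - {T1}" for T using that psubset.prems(1) by blast
      show "small_growth s (D T)" if "T \<in> U - {T1}" for T
        unfolding D_def using that psubset.prems(2) C'_sg T1 c_sg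
        by (intro small_growth_diff small_growth_mult s) auto
      fix z
      have "(\<Sum>T\<in>U. D T z * exp (poly T z)) =
          C' T1 z * (\<Sum>T\<in>U. C T z * exp (poly T z)) - c z * (\<Sum>T\<in>U. C' T z * exp (poly T z))"
        unfolding D_def sum_distrib_left sum_subtractf[symmetric]
        by (intro sum.cong) (auto simp: algebra_simps)
      then have "(\<Sum>T\<in>U. D T z * exp (poly T z)) = 0"
        using psubset.prems(3) sum' by simp
      moreover have "D T1 z = 0" by (simp add: D_def c_def)
      ultimately show "(\<Sum>T\<in>U - {T1}. D T z * exp (poly T z)) = 0"
        using psubset.hyps T1 by (simp add: sum.remove)
    qed
    \<comment> \<open>Division by \<open>c\<close> is possible only near a point where
      \<open>c\<close> does not vanish; the resulting proportionality is extended by the identity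
      theorem.\<close>
    obtain r where r: "r > 0" "\<And>z. z \<in> ball z1 r \<Longrightarrow> c z \<noteq> 0"
      using entire_nonzero_ball[OF c_hol, of z1] nz by (auto simp: c_def)
    have zero: "C T z = 0" if T: "T \<in> U - {T1}" for T z
    proof -
      define g where "g = (\<lambda>z. C T z * exp (poly (T - T1) z))"
      have g_hol: "g holomorphic_on UNIV"
        unfolding g_def using hol T by (auto intro!: holomorphic_intros)
      have "\<exists>k. \<forall>z\<in>ball z1 r. g z / c z = k"
      proof (rule has_field_derivative_zero_constant)
        show "convex (ball z1 r)" by simp
        fix z assume z: "z \<in> ball z1 r"
        have 1: "(g has_field_derivative
            (deriv (C T) z + poly (pderiv (T - T1)) z * C T z) * exp (poly (T - T1) z)) (at z)"
          unfolding g_def using T by (intro exp_term_deriv hol) auto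
        have 2: "(c has_field_derivative deriv c z) (at z)"
          using c_hol by (simp add: holomorphic_derivI)
        have "((\<lambda>z. g z / c z) has_field_derivative
            ((deriv (C T) z + poly (pderiv (T - T1)) z * C T z) * exp (poly (T - T1) z) * c z
              - g z * deriv c z) / (c z * c z)) (at z within ball z1 r)"
          using DERIV_divide[OF 1 2 r(2)[OF z]] by (rule has_field_derivative_at_within)
        moreover have "(deriv (C T) z + poly (pderiv (T - T1)) z * C T z) * exp (poly (T - T1) z) * c z
              - g z * deriv c z = - D T z * exp (poly (T - T1) z)"
          by (simp add: D_def C'_def g_def c_def pderiv_diff algebra_simps)
        ultimately show "((\<lambda>z. g z / c z) has_field_derivative 0) (at z within ball z1 r)"
          using D0[OF T] by simp
      qed
      then obtain k where k: "\<And>z. z \<in> ball z1 r \<Longrightarrow> g z = k * c z"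
        using r(2) by (metis nonzero_eq_divide_eq)
      have "g z - k * c z = 0" for z
        by (rule entire_zero_on_ball[OF _ r(1), where a = z1])
           (use k g_hol c_hol in \<open>auto intro!: holomorphic_intros\<close>)
      then have eq: "C T z * exp (poly (T - T1) z) = k * c z" for z by (simp add: g_def)
      show ?thesis
        using T T1 psubset.prems(1) psubset.prems(2)
        by (intro no_exp_quotient[OF s _ _ _ _ eq] high_poly_diff small_growth_cmult[OF s c_sg]) auto
    qed
    have "(\<Sum>T\<in>U. C T z1 * exp (poly T z1)) = C T1 z1 * exp (poly T1 z1)"
      using zero psubset.hyps T1 by (simp add: sum.remove)
    then show False using psubset.prems(3)[of z1] nz by simp
  qed
qed

section \<open>Maximum modulus and Nevanlinna characteristic\<close>

text \<open>On the unit circle these are the real trigonometric polynomials. Writing them as real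
  parts of polynomials provides the harmonic extension into the disc at the same time.\<close>

definition circle_harmonic :: "(complex \<Rightarrow> real) \<Rightarrow> bool" where
  "circle_harmonic u \<longleftrightarrow> continuous_on (sphere 0 1) u \<and> (\<exists>h :: complex poly. \<forall>z\<in>sphere 0 1. u z = Re (poly h z))"

lemma circle_harmonic_iff:
  "circle_harmonic u \<longleftrightarrow> (\<exists>h :: complex poly. \<forall>z\<in>sphere 0 1. u z = Re (poly h z))"
proof -
  have "continuous_on (sphere 0 1) u" if "\<forall>z\<in>sphere 0 1. u z = Re (poly h z)" for h :: "complex poly"
  proof -
    have "continuous_on (sphere 0 1) (\<lambda>z. Re (poly h z))" by (intro continuous_intros)
    then show ?thesis by (rule continuous_on_eq) (use that in auto)
  qed
  then show ?thesis by (auto simp: circle_harmonic_def)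
qed

lemma circle_harmonic_add:
  assumes "circle_harmonic u" "circle_harmonic v"
  shows "circle_harmonic (\<lambda>z. u z + v z)"
proof -
  obtain g h :: "complex poly"
    where "\<forall>z\<in>sphere 0 1. u z = Re (poly g z)" "\<forall>z\<in>sphere 0 1. v z = Re (poly h z)"
    using assms by (auto simp: circle_harmonic_iff)
  then show ?thesis unfolding circle_harmonic_iff by (intro exI[of _ "g + h"]) auto
qed

lemma circle_harmonic_sum:
  assumes "\<And>i. i \<in> I \<Longrightarrow> circle_harmonic (u i)"
  shows "circle_harmonic (\<lambda>z. \<Sum>i\<in>I. u i z)"
proof -
  have "circle_harmonic (\<lambda>_. 0)" by (auto simp: circle_harmonic_iff intro: exI[of _ 0])
  then show ?thesis using assms
    by (induction I rule: infinite_finite_induct) (auto intro!: circle_harmonic_add)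
qed

text \<open>Product-to-sum formula: 2 Re u Re v = Re (u v + cnj u v), and on the circle the
  conjugate of z^m is z^(-m). The ordering m <= n keeps the exponent n - m non-negative.\<close>

lemma circle_harmonic_monom_mult:
  "circle_harmonic (\<lambda>z. Re (a * z ^ m) * Re (b * z ^ n))"
proof (induction m n arbitrary: a b rule: linorder_wlog)
  case (le m n)
  define h where "h = smult (1/2) (monom (a * b) (m + n) + monom (cnj a * b) (n - m))"
  have "Re (a * z ^ m) * Re (b * z ^ n) = Re (poly h z)" if z: "z \<in> sphere 0 1" for z
  proof -
    have "z * cnj z = 1" using z by (simp add: complex_norm_square[symmetric])
    then have "cnj z ^ m * z ^ m = 1" by (metis mult.commute power_mult_distrib power_one)
    then have "cnj z ^ m * z ^ n = z ^ (n - m)"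
      using le by (metis le_add_diff_inverse mult.assoc mult_1 power_add)
    then have eq: "cnj a * b * z ^ (n - m) = cnj (a * z ^ m) * (b * z ^ n)"
      by (simp add: algebra_simps)
    have "poly h z = ((a * z ^ m) * (b * z ^ n) + cnj (a * z ^ m) * (b * z ^ n)) / 2"
      unfolding eq[symmetric] by (simp add: h_def poly_monom power_add algebra_simps)
    moreover have "Re u * Re v = Re ((u * v + cnj u * v) / 2)" for u v :: complex by simp
    ultimately show ?thesis by metis
  qed
  then show ?case unfolding circle_harmonic_iff by blast
next
  case (sym m n)
  show ?case using sym[of b a] by (simp add: mult.commute)
qed

lemma circle_harmonic_mult:
  assumes "circle_harmonic u" "circle_harmonic v"
  shows "circle_harmonic (\<lambda>z. u z * v z)"
proof -
  obtain g h :: "complex poly"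
    where gh: "\<forall>z\<in>sphere 0 1. u z = Re (poly g z)" "\<forall>z\<in>sphere 0 1. v z = Re (poly h z)"
    using assms by (auto simp: circle_harmonic_iff)
  have "circle_harmonic (\<lambda>z. \<Sum>i\<le>degree g. \<Sum>j\<le>degree h. Re (coeff g i * z ^ i) * Re (coeff h j * z ^ j))"
    by (intro circle_harmonic_sum circle_harmonic_monom_mult)
  moreover have "(\<Sum>i\<le>degree g. \<Sum>j\<le>degree h. Re (coeff g i * z ^ i) * Re (coeff h j * z ^ j))
      = Re (poly g z) * Re (poly h z)" for z
    by (simp only: poly_altdef Re_sum sum_product)
  ultimately show ?thesis using gh by (simp add: circle_harmonic_iff)
qed

text \<open>Stone-Weierstrass for the algebra of trigonometric polynomials; points are separated by
  \<open>Re z\<close> and \<open>Im z = Re (- \<i> * z)\<close>. The approximation stands in for the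
  Poisson extension of \<open>u\<close>.\<close>

lemma circle_harmonic_approx:
  assumes "continuous_on (sphere 0 1) u" "e > 0"
  shows "\<exists>h :: complex poly. \<forall>z\<in>sphere 0 1. \<bar>u z - Re (poly h z)\<bar> < e"
proof -
  have const: "circle_harmonic (\<lambda>_. c)" for c
    unfolding circle_harmonic_iff by (intro exI[of _ "[:of_real c:]"]) auto
  have "circle_harmonic (\<lambda>z. Re z)" "circle_harmonic (\<lambda>z. Im z)"
    unfolding circle_harmonic_iff
    by (rule exI[of _ "[:0, 1:]"], simp, rule exI[of _ "[:0, -\<i>:]"], simp)
  then have sep: "\<exists>f. circle_harmonic f \<and> f x \<noteq> f y" if "x \<noteq> y" for x y
    using that complex_eq_iff by blast
  have "\<exists>g. circle_harmonic g \<and> (\<forall>x\<in>sphere 0 1. \<bar>u x - g x\<bar> < e)"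
    by (rule Stone_Weierstrass_HOL[where P = circle_harmonic])
       (use assms const sep circle_harmonic_add circle_harmonic_mult in \<open>auto simp: circle_harmonic_def\<close>)
  then obtain g where g: "circle_harmonic g" "\<And>z. z \<in> sphere 0 1 \<Longrightarrow> \<bar>u z - g z\<bar> < e" by blast
  then obtain h :: "complex poly" where "\<And>z. z \<in> sphere 0 1 \<Longrightarrow> g z = Re (poly h z)"
    by (auto simp: circle_harmonic_iff)
  then show ?thesis using g(2) by (intro exI[of _ h]) metis
qed

section \<open>Mean value property and Harnack's inequality for polynomials\<close>

lemma poly_circle_mean:
  fixes h :: "complex poly"
  shows "((\<lambda>t. Re (poly h (exp (\<i> * complex_of_real t)))) has_integral 2 * pi * Re (poly h 0)) {0..2*pi}"
proof -
  have "((\<lambda>t. exp (\<i> * complex_of_real t) ^ n) has_integral (if n = 0 then 2 * pi else 0)) {0..2*pi}" for n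
  proof (cases "n = 0")
    case False
    have "((\<lambda>t. exp (\<i> * complex_of_real t) ^ n) has_integral
        (exp (\<i> * of_nat n * complex_of_real (2 * pi)) / (\<i> * of_nat n)
          - exp (\<i> * of_nat n * complex_of_real 0) / (\<i> * of_nat n))) {0..2*pi}"
    proof (rule fundamental_theorem_of_calculus)
      fix x :: real
      have "((\<lambda>z. exp (\<i> * of_nat n * z) / (\<i> * of_nat n)) has_field_derivative exp (\<i> * of_nat n * x)) (at (complex_of_real x))"
        using False by (auto intro!: derivative_eq_intros)
      then have "((\<lambda>t. exp (\<i> * of_nat n * complex_of_real t) / (\<i> * of_nat n)) has_vector_derivative exp (\<i> * of_nat n * x)) (at x within {0..2*pi})"
        by (rule has_vector_derivative_real_field[THEN has_vector_derivative_at_within])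
      then show "((\<lambda>t. exp (\<i> * of_nat n * complex_of_real t) / (\<i> * of_nat n)) has_vector_derivative exp (\<i> * x) ^ n) (at x within {0..2*pi})"
        by (simp add: exp_of_nat_mult[symmetric] mult_ac)
    qed auto
    moreover have "exp (\<i> * of_nat n * complex_of_real (2 * pi)) = 1"
      using exp_2pi_1_nat[of n] by (simp add: mult_ac)
    ultimately show ?thesis using False by simp
  qed (use has_integral_const_real[of "1::complex" 0 "2*pi"] in \<open>simp add: scaleR_conv_of_real\<close>)
  then have "((\<lambda>t. \<Sum>i\<le>degree h. coeff h i * exp (\<i> * complex_of_real t) ^ i) has_integral
      (\<Sum>i\<le>degree h. coeff h i * (if i = 0 then 2 * pi else 0))) {0..2*pi}"
    by (intro has_integral_sum has_integral_mult_right) auto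
  moreover have "(\<Sum>i\<le>degree h. coeff h i * (if i = 0 then 2 * pi else 0)) = poly h 0 * (2 * pi)"
  proof -
    have "(\<Sum>i\<le>degree h. coeff h i * complex_of_real (if i = 0 then 2 * pi else 0))
        = (\<Sum>i\<le>degree h. if i = 0 then coeff h 0 * (2 * pi) else 0)"
      by (intro sum.cong) auto
    then show ?thesis by (simp add: poly_0_coeff_0)
  qed
  ultimately have "((\<lambda>t. poly h (exp (\<i> * complex_of_real t))) has_integral poly h 0 * (2 * pi)) {0..2*pi}"
    by (simp add: poly_altdef)
  from has_integral_linear[OF this bounded_linear_Re] show ?thesis
    by (simp add: o_def mult_ac)
qed

text \<open>The map \<open>k\<close> is \<open>h\<close> followed by the Moebius map of the right
  half-plane onto the disc that sends h(0) to 0, so the Schwarz lemma gives |k(a)| <= 1/2. The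
  constant 3 is (1 + 1/2) / (1 - 1/2).\<close>

lemma Harnack_poly:
  fixes h :: "complex poly"
  assumes pos: "\<And>z. cmod z = 1 \<Longrightarrow> Re (poly h z) > 0" and a: "cmod a \<le> 1/2"
  shows "Re (poly h a) \<le> 3 * Re (poly h 0)"
proof -
  have pos': "Re (poly h z) > 0" if z: "cmod z < 1" for z
  proof -
    have "continuous_on (sphere 0 1) (\<lambda>z. Re (poly h z))" by (intro continuous_intros)
    then obtain m where m: "m \<in> sphere 0 1" "\<And>z. z \<in> sphere 0 1 \<Longrightarrow> Re (poly h m) \<le> Re (poly h z)"
      using continuous_attains_inf[of "sphere (0::complex) 1" "\<lambda>z. Re (poly h z)"] by auto
    \<comment> \<open>The minimum principle for the real part of \<open>h\<close> is the maximum
      principle for exp(-h).\<close>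
    have "cmod (exp (- poly h z)) \<le> exp (- Re (poly h m))"
      by (rule maximum_modulus_frontier[of _ "cball 0 1"])
         (use z m in \<open>auto intro!: holomorphic_intros continuous_intros simp: norm_exp_eq_Re\<close>)
    then show ?thesis using pos[of m] m(1) by (simp add: norm_exp_eq_Re)
  qed
  define h0 where "h0 = poly h 0"
  have h0: "Re h0 > 0" using pos'[of 0] by (simp add: h0_def)
  define k where "k = (\<lambda>z. (poly h z - h0) / (poly h z + cnj h0))"
  have den: "poly h z + cnj h0 \<noteq> 0" if "cmod z < 1" for z
  proof -
    have "Re (poly h z + cnj h0) > 0" using pos'[OF that] h0 by simp
    then show ?thesis by (metis zero_complex.sel(1) order_less_irrefl)
  qed
  have lt: "cmod (k z) < 1" if z: "cmod z < 1" for z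
  proof -
    have "cmod (poly h z - h0) ^ 2 < cmod (poly h z + cnj h0) ^ 2"
      using mult_pos_pos[OF pos'[OF z] h0]
      unfolding cmod_power2 by (simp add: power2_eq_square algebra_simps)
    then have "cmod (poly h z - h0) < cmod (poly h z + cnj h0)"
      using power_less_imp_less_base norm_ge_zero by blast
    then show ?thesis using den[OF z] by (simp add: k_def norm_divide divide_simps)
  qed
  have k: "cmod (k a) \<le> 1/2"
  proof -
    have "cmod (k a) \<le> cmod a"
    proof (rule Schwarz_Lemma(1)[OF _ _ lt])
      show "k holomorphic_on ball 0 1"
        unfolding k_def using den by (auto intro!: holomorphic_intros)
      show "k 0 = 0" by (simp add: k_def h0_def)
    qed (use a in auto)
    then show ?thesis using a by simp
  qed
  define P where "P = poly h a"
  have P: "Re P > 0" using pos'[of a] a by (simp add: P_def)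
  have "2 * cmod (P - h0) \<le> cmod (P + cnj h0)"
    using k den[of a] a by (simp add: k_def norm_divide divide_simps P_def split: if_splits)
  then have "(2 * cmod (P - h0))^2 \<le> (cmod (P + cnj h0))^2" by (intro power_mono) auto
  then have "4 * ((Re P - Re h0)^2 + (Im P - Im h0)^2) \<le> (Re P + Re h0)^2 + (Im P - Im h0)^2"
    by (simp add: power_mult_distrib cmod_power2)
  moreover have "4 * X \<le> Z" if "4 * (X + Y) \<le> Z + Y" "0 \<le> Y" for X Y Z :: real
    using that by argo
  ultimately have "4 * (Re P - Re h0)^2 \<le> (Re P + Re h0)^2" using zero_le_power2 by blast
  then have "(2 * (Re P - Re h0))^2 \<le> (Re P + Re h0)^2" by (subst power_mult_distrib) simp
  then have "2 * (Re P - Re h0) \<le> Re P + Re h0"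
    by (rule power2_le_imp_le) (use P h0 in auto)
  then show ?thesis by (simp add: P_def h0_def)
qed

lemma ln_max_1: "x \<ge> 0 \<Longrightarrow> max 0 (ln x) = ln (max 1 x)" for x :: real
  \<comment> \<open>At \<open>x = 0\<close> the conventional value of \<open>ln 0\<close> is at most
    0, so zeros of the function do no harm in the integrand of \<open>nev_T\<close>.\<close>
  by (cases "x = 0") (auto simp: max_def)

lemma continuous_on_nev_integrand:
  assumes "g holomorphic_on UNIV"
  shows "continuous_on S (\<lambda>t. max 0 (ln (cmod (g (complex_of_real r * exp (\<i> * complex_of_real t))))))"
proof -
  have "continuous_on UNIV g" using assms by (rule holomorphic_on_imp_continuous_on)
  then have "continuous_on S (\<lambda>t. g (complex_of_real r * exp (\<i> * complex_of_real t)))"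
    by (rule continuous_on_compose2) (auto intro!: continuous_intros)
  then have "continuous_on S (\<lambda>t. ln (max 1 (cmod (g (complex_of_real r * exp (\<i> * complex_of_real t))))))"
    by (intro continuous_on_ln continuous_on_max continuous_on_norm continuous_on_const) (auto simp: max_def)
  then show ?thesis by (simp add: ln_max_1)
qed

text \<open>On the circle of radius \<open>R\<close>, the logarithm of \<open>max 1 (cmod (g z))\<close> is approximated from above
  by the real part of a polynomial \<open>h\<close>; the maximum principle for \<open>g * exp (- h)\<close> and Harnack's
  inequality for \<open>h\<close> then replace the Poisson--Jensen formula.\<close>

theorem ln_norm_le_nev_T:
  assumes g: "g holomorphic_on UNIV" and R: "R > 0" and z: "cmod z \<le> R / 2"
  shows "ln (max 1 (cmod (g z))) \<le> 3 * nev_T g R"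
proof (rule field_le_epsilon)
  fix e :: real assume e: "e > 0"
  \<comment> \<open>On the circle the real part of \<open>h\<close> will exceed \<open>u\<close> by
    at most 2d; Harnack's factor turns this into 6d, which is below \<open>e\<close>.\<close>
  define d where "d = e / 8"
  have d: "d > 0" using e by (simp add: d_def)
  define u where "u = (\<lambda>w. ln (max 1 (cmod (g (of_real R * w)))))"
  have cont: "continuous_on UNIV g" using g by (rule holomorphic_on_imp_continuous_on)
  have "continuous_on (sphere 0 1) (\<lambda>w. g (of_real R * w))"
    by (rule continuous_on_compose2[OF cont]) (auto intro!: continuous_intros)
  then have "continuous_on (sphere 0 1) u" unfolding u_def
    by (intro continuous_on_ln continuous_on_max continuous_on_norm continuous_on_const) (auto simp: max_def)
  then obtain h0 where h0: "\<forall>w\<in>sphere 0 1. \<bar>u w - Re (poly h0 w)\<bar> < d"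
    using circle_harmonic_approx[OF _ d] by metis
  \<comment> \<open>Raising by \<open>d\<close> makes the approximation one-sided, and strictly
    positive because \<open>u\<close> is non-negative, as Harnack's inequality demands.\<close>
  define h where "h = h0 + [:of_real d:]"
  have h: "u w \<le> Re (poly h w)" "Re (poly h w) \<le> u w + 2 * d" "Re (poly h w) > 0" if "cmod w = 1" for w
  proof -
    have "u w \<ge> 0" by (simp add: u_def)
    moreover have "\<bar>u w - Re (poly h0 w)\<bar> < d" using h0 that by simp
    ultimately show "u w \<le> Re (poly h w)" "Re (poly h w) \<le> u w + 2 * d" "Re (poly h w) > 0"
      by (auto simp: h_def)
  qed
  define a where "a = z / of_real R"
  have a: "cmod a \<le> 1/2" "of_real R * a = z"
    using z R by (auto simp: a_def norm_divide field_simps)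
  have "cmod (g (of_real R * a) * exp (- poly h a)) \<le> 1"
  proof (rule maximum_modulus_frontier[where S = "cball 0 1"
        and f = "\<lambda>w. g (of_real R * w) * exp (- poly h w)"])
    have "(\<lambda>w. g (of_real R * w)) holomorphic_on UNIV"
      using holomorphic_on_compose[of "\<lambda>w. of_real R * w" UNIV g] g
      by (auto simp: o_def intro!: holomorphic_intros intro: holomorphic_on_subset)
    then have hol: "(\<lambda>w. g (of_real R * w) * exp (- poly h w)) holomorphic_on UNIV"
      by (intro holomorphic_intros)
    then show "(\<lambda>w. g (of_real R * w) * exp (- poly h w)) holomorphic_on interior (cball 0 1)"
      and "continuous_on (closure (cball 0 1)) (\<lambda>w. g (of_real R * w) * exp (- poly h w))"
      by (auto intro: holomorphic_on_subset holomorphic_on_imp_continuous_on)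
    fix w :: complex assume "w \<in> frontier (cball 0 1)"
    then have "cmod w = 1" by auto
    have "cmod (g (of_real R * w)) \<le> max 1 (cmod (g (of_real R * w)))" by simp
    also have "\<dots> = exp (u w)" by (simp add: u_def)
    also have "\<dots> \<le> exp (Re (poly h w))" using h(1)[OF \<open>cmod w = 1\<close>] by simp
    finally show "cmod (g (of_real R * w) * exp (- poly h w)) \<le> 1"
      unfolding norm_mult norm_exp_eq_Re by (simp add: exp_minus divide_simps)
  qed (use a in auto)
  then have le: "cmod (g z) \<le> exp (Re (poly h a))"
    unfolding norm_mult norm_exp_eq_Re using a(2) by (simp add: exp_minus divide_simps)
  have pos: "Re (poly h 0) \<ge> 0" and Har: "Re (poly h a) \<le> 3 * Re (poly h 0)"
    using Harnack_poly[OF h(3), of 0] Harnack_poly[OF h(3) a(1)] by auto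
  then have "cmod (g z) \<le> exp (3 * Re (poly h 0))" using le by (elim order_trans) simp
  then have "max 1 (cmod (g z)) \<le> exp (3 * Re (poly h 0))" using pos by simp
  then have "ln (max 1 (cmod (g z))) \<le> ln (exp (3 * Re (poly h 0)))"
    by (subst ln_le_cancel_iff) auto
  then have "ln (max 1 (cmod (g z))) \<le> 3 * Re (poly h 0)" by simp
  \<comment> \<open>The mean of the real part of \<open>h\<close> over the circle is its value at 0,
    and the mean of \<open>u\<close> is \<open>nev_T g R\<close>.\<close>
  moreover have "2 * pi * Re (poly h 0) \<le> 2 * pi * nev_T g R + 2 * d * (2 * pi)"
  proof -
    have "(\<lambda>t. u (exp (\<i> * complex_of_real t))) integrable_on {0..2*pi}"
      using integrable_continuous_interval[OF continuous_on_nev_integrand[OF g, of _ R]]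
      by (simp add: u_def ln_max_1)
    then have 1: "((\<lambda>t. u (exp (\<i> * complex_of_real t))) has_integral 2 * pi * nev_T g R) {0..2*pi}"
      by (simp add: nev_T_def u_def ln_max_1 integrable_integral)
    have 2: "((\<lambda>t. u (exp (\<i> * complex_of_real t)) + 2 * d) has_integral 2 * pi * nev_T g R + 2 * d * (2 * pi)) {0..2*pi}"
      using has_integral_add[OF 1 has_integral_const_real[of "2*d" 0 "2*pi"]] by (simp add: mult_ac)
    show ?thesis
      by (rule has_integral_le[OF poly_circle_mean 2]) (use h(2) in auto)
  qed
  then have "2 * pi * Re (poly h 0) \<le> 2 * pi * (nev_T g R + 2 * d)"
    by (simp add: algebra_simps)
  then have "Re (poly h 0) \<le> nev_T g R + 2 * d"
    by (subst (asm) mult_le_cancel_left_pos) auto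
  ultimately show "ln (max 1 (cmod (g z))) \<le> 3 * nev_T g R + e" using e unfolding d_def by linarith
qed

section \<open>Growth of exponential polynomials\<close>

text \<open>Only the degrees of the exponents are bounded, not those of the factors
  \<open>P\<close>; thus \<open>d\<close> is an upper bound for the order that need not be attained.
  The inductive form yields the closure properties by rule induction.\<close>

inductive exp_poly_deg :: "nat \<Rightarrow> (complex \<Rightarrow> complex) \<Rightarrow> bool" for d where
  zero: "exp_poly_deg d (\<lambda>_. 0)"
| add_term: "degree Q \<le> d \<Longrightarrow> exp_poly_deg d g \<Longrightarrow> exp_poly_deg d (\<lambda>z. poly P z * exp (poly Q z) + g z)"

section \<open>Closure properties under a bound on the degrees of the exponents\<close>

lemma exp_poly_deg_imp_exp_poly:
  assumes "exp_poly_deg d f"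
  shows "exp_poly f"
  using assms
proof induction
  case zero
  show ?case unfolding exp_poly_def by (rule exI[of _ "[]"]) simp
next
  case (add_term Q g P)
  then obtain ps where "\<forall>z. g z = (\<Sum>(P, Q)\<leftarrow>ps. poly P z * exp (poly Q z))"
    by (auto simp: exp_poly_def)
  then show ?case unfolding exp_poly_def by (intro exI[of _ "(P, Q) # ps"]) simp
qed

lemma exp_poly_deg_mono: "exp_poly_deg d f \<Longrightarrow> d \<le> e \<Longrightarrow> exp_poly_deg e f"
  by (induction rule: exp_poly_deg.induct) (auto intro: exp_poly_deg.intros)

lemma exp_poly_imp_exp_poly_deg:
  assumes "exp_poly f"
  shows "\<exists>d. exp_poly_deg d f"
proof -
  obtain ps where "f = (\<lambda>z. \<Sum>(P, Q)\<leftarrow>ps. poly P z * exp (poly Q z))"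
    using assms by (auto simp: exp_poly_def)
  moreover have "\<exists>d. exp_poly_deg d (\<lambda>z. \<Sum>(P, Q)\<leftarrow>ps. poly P z * exp (poly Q z))"
  proof (induction ps)
    case Nil
    then show ?case by (auto intro: exp_poly_deg.zero)
  next
    case (Cons PQ ps)
    obtain P Q where PQ: "PQ = (P, Q)" by force
    obtain d where "exp_poly_deg d (\<lambda>z. \<Sum>(P, Q)\<leftarrow>ps. poly P z * exp (poly Q z))"
      using Cons by blast
    then have "exp_poly_deg (max d (degree Q)) (\<lambda>z. \<Sum>(P, Q)\<leftarrow>ps. poly P z * exp (poly Q z))"
      by (rule exp_poly_deg_mono) simp
    then have "exp_poly_deg (max d (degree Q)) (\<lambda>z. poly P z * exp (poly Q z) + (\<Sum>(P, Q)\<leftarrow>ps. poly P z * exp (poly Q z)))"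
      by (intro exp_poly_deg.add_term) auto
    then show ?case unfolding PQ by auto
  qed
  ultimately show ?thesis by simp
qed

lemma exp_poly_deg_term: "degree Q \<le> d \<Longrightarrow> exp_poly_deg d (\<lambda>z. poly P z * exp (poly Q z))"
  using exp_poly_deg.add_term[OF _ exp_poly_deg.zero] by simp

lemma exp_poly_deg_poly: "exp_poly_deg d (poly P)"
  using exp_poly_deg_term[of 0 d P] by simp

lemma exp_poly_deg_const: "exp_poly_deg d (\<lambda>_. c)"
proof -
  have "poly [:c:] = (\<lambda>_. c)" by (simp add: fun_eq_iff)
  then show ?thesis using exp_poly_deg_poly[of d "[:c:]"] by simp
qed

lemma exp_poly_deg_add:
  assumes "exp_poly_deg d f" "exp_poly_deg d g"
  shows "exp_poly_deg d (\<lambda>z. f z + g z)"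
  using assms
  by (induction rule: exp_poly_deg.induct) (auto simp: add.assoc intro: exp_poly_deg.intros)

lemma exp_poly_deg_sum:
  "(\<And>i. i \<in> I \<Longrightarrow> exp_poly_deg d (f i)) \<Longrightarrow> exp_poly_deg d (\<lambda>z. \<Sum>i\<in>I. f i z)"
  by (induction I rule: infinite_finite_induct) (auto intro: exp_poly_deg_add exp_poly_deg.zero)

lemma exp_poly_deg_term_mult:
  assumes "exp_poly_deg d g" "degree Q \<le> d"
  shows "exp_poly_deg d (\<lambda>z. poly P z * exp (poly Q z) * g z)"
  using assms(1)
proof induction
  case (add_term Q' g P')
  have "degree (Q + Q') \<le> d" using add_term(1) assms(2) by (simp add: degree_add_le)
  from exp_poly_deg.add_term[OF this add_term.IH, of "P * P'"] show ?case
    by (simp add: exp_add algebra_simps)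
qed (auto intro: exp_poly_deg.zero)

lemma exp_poly_deg_mult:
  assumes "exp_poly_deg d f" "exp_poly_deg d g"
  shows "exp_poly_deg d (\<lambda>z. f z * g z)"
  using assms(1)
proof induction
  case (add_term Q f P)
  show ?case
    using exp_poly_deg_add[OF exp_poly_deg_term_mult[OF assms(2) add_term(1), of P] add_term.IH]
    by (simp add: algebra_simps)
qed (auto intro: exp_poly_deg.zero)

lemma exp_poly_deg_holomorphic: "exp_poly_deg d f \<Longrightarrow> f holomorphic_on UNIV"
  by (induction rule: exp_poly_deg.induct) (auto intro!: holomorphic_intros)

lemma exp_poly_deg_deriv: "exp_poly_deg d f \<Longrightarrow> exp_poly_deg d (deriv f)"
proof (induction rule: exp_poly_deg.induct)
  case zero
  then show ?case by (simp add: exp_poly_deg.zero)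
next
  case (add_term Q g P)
  have g: "(g has_field_derivative deriv g z) (at z)" for z
    using exp_poly_deg_holomorphic[OF add_term(2)] by (simp add: holomorphic_derivI)
  have "((\<lambda>z. poly P z * exp (poly Q z) + g z) has_field_derivative
      poly (pderiv P + pderiv Q * P) z * exp (poly Q z) + deriv g z) (at z)" for z
    by (auto intro!: derivative_eq_intros poly_DERIV g simp: algebra_simps)
  then have "deriv (\<lambda>z. poly P z * exp (poly Q z) + g z) =
      (\<lambda>z. poly (pderiv P + pderiv Q * P) z * exp (poly Q z) + deriv g z)"
    using DERIV_imp_deriv by blast
  then show ?case using exp_poly_deg.add_term[OF add_term(1) add_term.IH, of "pderiv P + pderiv Q * P"]
    by (simp only:)
qed

lemma exp_poly_deg_small_growth:
  assumes "exp_poly_deg d f" "d < s"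
  shows "small_growth s f"
  using assms(1)
proof induction
  case zero
  then show ?case using assms(2) by (simp add: small_growth_const)
next
  case (add_term Q g P)
  then show ?case using assms(2)
    by (intro small_growth_add small_growth_mult small_growth_poly small_growth_exp_poly) auto
qed

text \<open>The comparison function \<open>b\<close> is left open because two are needed: r^d for
  positive d, and r^d (1 + ln r), which dominates polynomials even when d = 0.\<close>

lemma exp_poly_deg_bound:
  assumes "exp_poly_deg d f"
    and b: "\<And>r. r \<ge> 1 \<Longrightarrow> r ^ d \<le> b r" "\<And>r. r \<ge> 1 \<Longrightarrow> 1 + ln r \<le> b r"
  shows "\<exists>C\<ge>0. \<forall>z. cmod z \<ge> 1 \<longrightarrow> cmod (f z) \<le> exp (C * b (cmod z))"
  using assms(1)
proof induction
  case zero
  then show ?case by (intro exI[of _ 0]) simp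
next
  case (add_term Q g P)
  obtain C where C: "C \<ge> 0" "\<And>z. cmod z \<ge> 1 \<Longrightarrow> cmod (g z) \<le> exp (C * b (cmod z))"
    using add_term.IH by blast
  obtain K where K: "K \<ge> 0" "\<And>z. cmod z \<ge> 1 \<Longrightarrow> cmod (poly P z) \<le> K * cmod z ^ degree P"
    using poly_norm_bound[of P] by blast
  obtain M where M: "M \<ge> 0" "\<And>z. cmod z \<ge> 1 \<Longrightarrow> cmod (poly Q z) \<le> M * cmod z ^ degree Q"
    using poly_norm_bound[of Q] by blast
  \<comment> \<open>\<open>K\<close> comes from K <= exp K, \<open>degree P\<close> from r^n = exp
    (n ln r), and \<open>M\<close> from the exponent. The additional 1 in the witness below pays for
    the factor 2 that arises from adding two terms.\<close>
  define C' where "C' = K + degree P + M"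
  have C': "C' \<ge> 0" using K M by (simp add: C'_def)
  show ?case
  proof (intro exI[of _ "1 + (C' + C)"] conjI allI impI)
    show "1 + (C' + C) \<ge> 0" using C(1) C' by simp
    fix z :: complex assume z: "cmod z \<ge> 1"
    define r where "r = cmod z"
    have r: "r \<ge> 1" "r > 0" "ln r \<ge> 0" using z by (auto simp: r_def)
    have br: "b r \<ge> 1" "ln r \<le> b r" using b(2)[OF r(1)] r(3) by auto
    have "cmod (poly P z) \<le> K * r ^ degree P" using K(2)[OF z] by (simp add: r_def)
    also have "\<dots> \<le> exp K * exp (degree P * ln r)"
    proof (rule mult_mono)
      show "K \<le> exp K" using exp_ge_add_one_self[of K] by linarith
      show "r ^ degree P \<le> exp (degree P * ln r)" using r by (simp add: exp_of_nat_mult)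
    qed (use r in auto)
    also have "\<dots> \<le> exp ((K + degree P) * b r)"
    proof -
      have "K * 1 + degree P * ln r \<le> K * b r + degree P * b r"
        using br K(1) by (intro add_mono mult_left_mono) auto
      then show ?thesis by (simp add: distrib_right flip: exp_add)
    qed
    finally have 1: "cmod (poly P z) \<le> exp ((K + degree P) * b r)" .
    have "cmod (exp (poly Q z)) \<le> exp (cmod (poly Q z))"
      by (simp add: norm_exp_eq_Re complex_Re_le_cmod)
    also have "cmod (poly Q z) \<le> M * b r"
    proof -
      have "cmod (poly Q z) \<le> M * r ^ degree Q" using M(2)[OF z] by (simp add: r_def)
      also have "\<dots> \<le> M * r ^ d" using r M(1) add_term(1) by (intro mult_left_mono power_increasing) auto
      also have "\<dots> \<le> M * b r" using M(1) b(1)[OF r(1)] by (intro mult_left_mono) auto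
      finally show ?thesis .
    qed
    finally have 2: "cmod (exp (poly Q z)) \<le> exp (M * b r)" by simp
    have "cmod (poly P z * exp (poly Q z)) \<le> exp ((K + degree P) * b r) * exp (M * b r)"
      unfolding norm_mult using 1 2 by (intro mult_mono) auto
    also have "\<dots> = exp (C' * b r)" by (simp add: C'_def distrib_right flip: exp_add)
    also have "\<dots> \<le> exp (C' * b r + C * b r)" using C(1) br by simp
    finally have 3: "cmod (poly P z * exp (poly Q z)) \<le> exp (C' * b r + C * b r)" .
    have "cmod (g z) \<le> exp (C * b r)" using C(2)[OF z] by (simp add: r_def)
    also have "\<dots> \<le> exp (C' * b r + C * b r)" using C' br by simp
    finally have 4: "cmod (g z) \<le> exp (C' * b r + C * b r)" .
    have "cmod (poly P z * exp (poly Q z) + g z) \<le> 2 * exp (C' * b r + C * b r)"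
      using 3 4 norm_triangle_ineq[of "poly P z * exp (poly Q z)" "g z"] by linarith
    also have "\<dots> \<le> exp (b r) * exp (C' * b r + C * b r)"
    proof (rule mult_right_mono)
      show "2 \<le> exp (b r)" using exp_ge_add_one_self[of "b r"] br by linarith
    qed simp
    also have "\<dots> = exp ((1 + (C' + C)) * b r)" by (simp add: algebra_simps flip: exp_add)
    finally show "cmod (poly P z * exp (poly Q z) + g z) \<le> exp ((1 + (C' + C)) * b (cmod z))"
      by (simp add: r_def)
  qed
qed

lemma exp_poly_deg_exp_bound:
  assumes "exp_poly_deg d f" "d > 0"
  shows "\<exists>C\<ge>0. \<forall>z. cmod z \<ge> 1 \<longrightarrow> cmod (f z) \<le> exp (C * cmod z ^ d)"
proof (rule exp_poly_deg_bound[OF assms(1), of "\<lambda>r. r ^ d"])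
  fix r :: real assume r: "r \<ge> 1"
  have "1 + ln r \<le> r" using ln_le_minus_one[of r] r by simp
  also have "r \<le> r ^ d" using r assms(2) by (simp add: self_le_power)
  finally show "1 + ln r \<le> r ^ d" .
qed auto

section \<open>Maximum modulus and order of growth\<close>

lemma max_mod_le:
  assumes "r \<ge> 0" "\<And>z. cmod z = r \<Longrightarrow> cmod (f z) \<le> K"
  shows "max_mod f r \<le> K"
  unfolding max_mod_def using assms by (intro cSUP_least) auto

lemma norm_le_max_mod:
  assumes "f holomorphic_on UNIV"
  shows "cmod (f z) \<le> max_mod f (cmod z)"
  unfolding max_mod_def
proof (rule cSUP_upper)
  have "continuous_on UNIV f" using assms by (rule holomorphic_on_imp_continuous_on)
  then have "continuous_on (sphere 0 (cmod z)) (\<lambda>z. cmod (f z))"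
    by (intro continuous_on_norm) (rule continuous_on_subset, auto)
  then have "compact ((\<lambda>z. cmod (f z)) ` sphere 0 (cmod z))"
    by (intro compact_continuous_image) auto
  then show "bdd_above ((\<lambda>z. cmod (f z)) ` sphere 0 (cmod z))"
    by (intro bounded_imp_bdd_above compact_imp_bounded)
qed auto

text \<open>The factor 1 + ln r lets d = 0 be treated together with the other cases; it disappears
  in the order because ln (1 + ln r) / ln r tends to 0.\<close>

lemma entire_order_le:
  assumes "exp_poly_deg d f"
  shows "entire_order f \<le> ereal (real d)"
proof -
  have "\<exists>C\<ge>0. \<forall>z. cmod z \<ge> 1 \<longrightarrow> cmod (f z) \<le> exp (C * (cmod z ^ d * (1 + ln (cmod z))))"
  proof (rule exp_poly_deg_bound[OF assms, of "\<lambda>r. r ^ d * (1 + ln r)"])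
    fix r :: real assume r: "r \<ge> 1"
    then have 1: "r ^ d \<ge> 1" "1 + ln r \<ge> 1" by (auto simp: one_le_power)
    show "r ^ d \<le> r ^ d * (1 + ln r)" using mult_left_mono[OF 1(2), of "r ^ d"] 1(1) by simp
    show "1 + ln r \<le> r ^ d * (1 + ln r)" using mult_right_mono[OF 1(1), of "1 + ln r"] 1(2) by simp
  qed
  then obtain C where C: "C \<ge> 0"
    "\<And>z. cmod z \<ge> 1 \<Longrightarrow> cmod (f z) \<le> exp (C * (cmod z ^ d * (1 + ln (cmod z))))" by blast
  define u where "u = (\<lambda>r. real d + (ln (C + 1) + ln (1 + ln r)) / ln r)"
  have "(u \<longlongrightarrow> real d + 0) at_top"
    unfolding u_def by (intro tendsto_intros) real_asymp
  then have u: "((\<lambda>r. ereal (u r)) \<longlongrightarrow> ereal (real d)) at_top" by simp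
  have "\<forall>\<^sub>F r in at_top. ln (max 1 (ln (max 1 (max_mod f r)))) / ln r \<le> u r"
    using eventually_gt_at_top[of 1]
  proof eventually_elim
    case (elim r)
    define v where "v = r ^ d * (1 + ln r)"
    have lnr: "ln r > 0" using elim by simp
    have v: "v \<ge> 1" unfolding v_def using mult_mono[of 1 "r ^ d" 1 "1 + ln r"] elim lnr by (simp add: one_le_power)
    have "max_mod f r \<le> exp (C * v)"
      unfolding v_def using elim C(2) by (intro max_mod_le) auto
    moreover have "exp (C * v) \<ge> 1" using C(1) v by simp
    ultimately have "ln (max 1 (max_mod f r)) \<le> ln (exp (C * v))"
      by (subst ln_le_cancel_iff) auto
    then have "ln (max 1 (max_mod f r)) \<le> C * v" by simp
    also have "C * v \<le> (C + 1) * v" using v by (simp add: algebra_simps)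
    finally have "max 1 (ln (max 1 (max_mod f r))) \<le> (C + 1) * v"
      using mult_mono[of 1 "C + 1" 1 v] C(1) v by simp
    then have "ln (max 1 (ln (max 1 (max_mod f r)))) \<le> ln ((C + 1) * v)"
      by (subst ln_le_cancel_iff) (use C(1) v in \<open>auto intro!: mult_pos_pos\<close>)
    also have "\<dots> = ln (C + 1) + ln v" using C(1) v by (intro ln_mult_pos) auto
    also have "ln v = ln (r ^ d) + ln (1 + ln r)"
      unfolding v_def by (rule ln_mult_pos) (use elim lnr in simp, use lnr in linarith)
    also have "ln (r ^ d) = real d * ln r" using elim by (simp add: ln_realpow)
    finally have "ln (max 1 (ln (max 1 (max_mod f r)))) / ln r
        \<le> (ln (C + 1) + (real d * ln r + ln (1 + ln r))) / ln r"
      using lnr by (simp add: divide_right_mono)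
    also have "\<dots> = u r" using lnr by (simp add: u_def field_simps)
    finally show ?case .
  qed
  then have "entire_order f \<le> Limsup at_top (\<lambda>r. ereal (u r))"
    unfolding entire_order_def by (intro Limsup_mono) simp
  also have "\<dots> = ereal (real d)" using u by (intro lim_imp_Limsup) auto
  finally show ?thesis .
qed

text \<open>Any \<open>y\<close> strictly between the order and \<open>q\<close> bounds the maximum
  modulus by exp(r^y), and r^y = o(r^q). This serves to bound orders from below by
  contradiction.\<close>

lemma small_growth_if_entire_order_less:
  assumes f: "f holomorphic_on UNIV" and less: "entire_order f < ereal (real q)"
  shows "small_growth q f"
proof -
  obtain y where y: "entire_order f < ereal y" "ereal y < ereal (real q)"
    using ereal_dense2[OF less] by blast
  then have "y < real q" by simp
  have "\<forall>\<^sub>F r in at_top. ereal (ln (max 1 (ln (max 1 (max_mod f r)))) / ln r) < ereal y"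
    using y(1) unfolding entire_order_def by (rule Limsup_lessD)
  then have ev: "\<forall>\<^sub>F r in at_top. max_mod f r \<le> exp (r powr y)"
    using eventually_gt_at_top[of 1]
  proof eventually_elim
    case (elim r)
    define m where "m = max 1 (ln (max 1 (max_mod f r)))"
    have "ln r > 0" using elim by simp
    then have "ln m \<le> y * ln r" using elim(1) by (simp add: m_def field_simps)
    then have "exp (ln m) \<le> exp (y * ln r)" by simp
    then have "m \<le> r powr y" using elim(2) by (simp add: m_def powr_def)
    then have "ln (max 1 (max_mod f r)) \<le> r powr y" by (simp add: m_def)
    then have "exp (ln (max 1 (max_mod f r))) \<le> exp (r powr y)" by (subst exp_le_cancel_iff)
    also have "exp (ln (max 1 (max_mod f r))) = max 1 (max_mod f r)" by simp
    finally show ?case by simp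
  qed
  show ?thesis
    unfolding small_growth_def
  proof (intro conjI allI impI f)
    fix e :: real assume e: "e > 0"
    have "\<forall>\<^sub>F r in at_top. r powr y \<le> e * r powr real q"
      using e \<open>y < real q\<close> by real_asymp
    with ev eventually_gt_at_top[of 0] have "\<forall>\<^sub>F r in at_top. max_mod f r \<le> exp (e * r ^ q)"
    proof eventually_elim
      case (elim r)
      then have "exp (r powr y) \<le> exp (e * r ^ q)" by (simp add: powr_realpow)
      then show ?case using elim(1) by linarith
    qed
    then have "\<forall>\<^sub>F z in at_infinity. max_mod f (cmod z) \<le> exp (e * cmod z ^ q)"
      by (rule eventually_compose_filterlim) (rule filterlim_norm_at_top)
    then show "\<forall>\<^sub>F z in at_infinity. cmod (f z) \<le> exp (e * cmod z ^ q)"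
      by eventually_elim (rule order_trans[OF norm_le_max_mod[OF f]])
  qed
qed

section \<open>Estimates of the Nevanlinna characteristic\<close>

lemma nev_T_nonneg: "nev_T g r \<ge> 0"
proof -
  define u where "u = (\<lambda>t. max 0 (ln (cmod (g (complex_of_real r * exp (\<i> * complex_of_real t))))))"
  have "integral {0..2*pi} u \<ge> 0"
    \<comment> \<open>\<open>g\<close> is arbitrary here; the integral of a non-integrable function
      is 0 by convention.\<close>
    by (cases "u integrable_on {0..2*pi}")
       (auto simp: not_integrable_integral u_def intro!: Henstock_Kurzweil_Integration.integral_nonneg)
  then show ?thesis by (simp add: nev_T_def u_def)
qed

lemma nev_T_le:
  assumes g: "g holomorphic_on UNIV" and r: "r > 0" and K: "K \<ge> 0"
    and le: "\<And>z. cmod z = r \<Longrightarrow> cmod (g z) \<le> exp K"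
  shows "nev_T g r \<le> K"
proof -
  define u where "u = (\<lambda>t. max 0 (ln (cmod (g (complex_of_real r * exp (\<i> * complex_of_real t))))))"
  have "norm (integral {0..2*pi} u) \<le> K * (2 * pi - 0)"
  proof (rule integral_bound)
    show "continuous_on {0..2*pi} u" unfolding u_def by (rule continuous_on_nev_integrand[OF g])
    fix t :: real
    define w where "w = complex_of_real r * exp (\<i> * complex_of_real t)"
    have "cmod w = r" using r by (simp add: w_def norm_mult)
    then have "max 1 (cmod (g w)) \<le> exp K" using le K by simp
    then have "ln (max 1 (cmod (g w))) \<le> ln (exp K)" by (subst ln_le_cancel_iff) auto
    then have "max 0 (ln (cmod (g w))) \<le> K" by (simp add: ln_max_1)
    then show "norm (u t) \<le> K" by (simp add: u_def w_def)
  qed auto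
  then have "integral {0..2*pi} u \<le> K * (2 * pi)" by simp
  then show ?thesis by (simp add: nev_T_def u_def field_simps)
qed

lemma small_growth_if_nev_T_smallo:
  assumes s: "s > 0" and A: "A holomorphic_on UNIV" and B: "B holomorphic_on UNIV"
    and C: "C \<ge> 0" "\<And>z. cmod z \<ge> 1 \<Longrightarrow> cmod (A z) \<le> exp (C * cmod z ^ s)"
    and o: "(\<lambda>r. nev_T B r) \<in> o[at_top](\<lambda>r. nev_T A r)"
  shows "small_growth s B"
  unfolding small_growth_def
proof (intro conjI allI impI B)
  fix e :: real assume e: "e > 0"
  \<comment> \<open>The 3 is the constant of \<open>ln_norm_le_nev_T\<close>, 2 ^ s comes from the
    radius 2|z|, and C + 1 replaces C to exclude a division by 0.\<close>
  define c where "c = e / (3 * 2 ^ s * (C + 1))"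
  have c: "c > 0" using e C(1) by (simp add: c_def)
  have "\<forall>\<^sub>F r in at_top. norm (nev_T B r) \<le> c * norm (nev_T A r)"
    using landau_o.smallD[OF o c] .
  then obtain b where b: "\<And>r. r \<ge> b \<Longrightarrow> nev_T B r \<le> c * nev_T A r"
    by (auto simp: eventually_at_top_linorder nev_T_nonneg)
  show "\<forall>\<^sub>F z in at_infinity. cmod (B z) \<le> exp (e * cmod z ^ s)"
    using eventually_norm_ge[of b] eventually_norm_ge[of 1]
  proof eventually_elim
    case (elim z)
    define R where "R = 2 * cmod z"
    have R: "R > 0" "R \<ge> b" "R \<ge> 1" using elim by (auto simp: R_def)
    have "ln (max 1 (cmod (B z))) \<le> 3 * nev_T B R"
      using R(1) by (intro ln_norm_le_nev_T[OF B]) (auto simp: R_def)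
    also have "\<dots> \<le> 3 * (c * nev_T A R)" using b[OF R(2)] by simp
    also have "\<dots> \<le> 3 * (c * (C * R ^ s))"
      using c C R by (intro mult_left_mono nev_T_le A) auto
    also have "\<dots> \<le> 3 * (c * ((C + 1) * R ^ s))"
      using c R by (intro mult_left_mono mult_right_mono) auto
    also have "\<dots> = e * cmod z ^ s"
    proof -
      have "C + 1 \<noteq> 0" using C(1) by linarith
      then show ?thesis by (simp add: c_def R_def power_mult_distrib)
    qed
    finally have "exp (ln (max 1 (cmod (B z)))) \<le> exp (e * cmod z ^ s)" by (subst exp_le_cancel_iff)
    also have "exp (ln (max 1 (cmod (B z)))) = max 1 (cmod (B z))" by simp
    finally show ?case by simp
  qed
qed

text \<open>Each exponent is split at degree \<open>s\<close>: its lower part goes into the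
  coefficient, and terms with the same upper part are merged. \<open>F\<close> is total and zero off
  \<open>U\<close>, so that coefficients at shifted exponents can be written without side
  conditions.\<close>

lemma exp_poly_decomposition:
  assumes "exp_poly_deg n f" "s > 0"
  shows "\<exists>U F. finite U \<and> (\<forall>T\<in>U. high_poly s T \<and> degree T \<le> n \<and> F T \<noteq> (\<lambda>_. 0)) \<and>
      (\<forall>T. T \<notin> U \<longrightarrow> F T = (\<lambda>_. 0)) \<and> (\<forall>T. exp_poly_deg (s - 1) (F T)) \<and>
      (\<forall>z. f z = (\<Sum>T\<in>U. F T z * exp (poly T z)))"
proof -
  have "\<exists>U F. finite U \<and> (\<forall>T\<in>U. high_poly s T \<and> degree T \<le> n) \<and>
      (\<forall>T. T \<notin> U \<longrightarrow> F T = (\<lambda>_. 0)) \<and> (\<forall>T. exp_poly_deg (s - 1) (F T)) \<and>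
      (\<forall>z. f z = (\<Sum>T\<in>U. F T z * exp (poly T z)))"
    using assms(1)
  proof induction
    case zero
    show ?case
      by (rule exI[of _ "{}"], rule exI[of _ "\<lambda>_ _. 0"]) (auto intro: exp_poly_deg.zero)
  next
    case (add_term Q g P)
    then obtain U F where UF: "finite U" "\<forall>T\<in>U. high_poly s T \<and> degree T \<le> n"
      "\<forall>T. T \<notin> U \<longrightarrow> F T = (\<lambda>_. 0)" "\<forall>T. exp_poly_deg (s - 1) (F T)"
      "\<forall>z. g z = (\<Sum>T\<in>U. F T z * exp (poly T z))" by blast
    define R where "R = poly_cutoff s Q"
    define T where "T = Q - R"
    have R: "degree R \<le> s - 1"
      unfolding R_def by (intro degree_le) (auto simp: coeff_poly_cutoff)
    have T: "high_poly s T" by (auto simp: high_poly_def T_def R_def coeff_poly_cutoff)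
    have T': "degree T \<le> n"
      using add_term(1) by (intro degree_le) (auto simp: T_def R_def coeff_poly_cutoff coeff_eq_0)
    \<comment> \<open>Because \<open>F\<close> vanishes off \<open>U\<close>, one update covers both
      a new exponent and one already present.\<close>
    define F' where "F' = F(T := (\<lambda>z. poly P z * exp (poly R z) + F T z))"
    show ?case
    proof (rule exI[of _ "insert T U"], rule exI[of _ F'], intro conjI allI impI ballI)
      show "exp_poly_deg (s - 1) (F' S)" for S
        using exp_poly_deg.add_term[OF R UF(4)[rule_format], of P] UF(4) by (simp add: F'_def)
      fix z
      have eq: "poly Q z = poly R z + poly T z" by (simp add: T_def)
      have "(\<Sum>S\<in>insert T U. F' S z * exp (poly S z)) =
          (\<Sum>S\<in>insert T U. (if S = T then poly P z * exp (poly Q z) else 0) + F S z * exp (poly S z))"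
        by (intro sum.cong) (auto simp: F'_def eq exp_add algebra_simps)
      also have "\<dots> = poly P z * exp (poly Q z) + (\<Sum>S\<in>insert T U. F S z * exp (poly S z))"
        using UF(1) by (simp add: sum.distrib)
      also have "(\<Sum>S\<in>insert T U. F S z * exp (poly S z)) = g z"
        using UF(1,3,5) by (cases "T \<in> U") (auto simp: insert_absorb)
      finally show "poly P z * exp (poly Q z) + g z = (\<Sum>S\<in>insert T U. F' S z * exp (poly S z))" by simp
    qed (use UF T T' in \<open>auto simp: F'_def\<close>)
  qed
  then obtain U F where UF: "finite U" "\<forall>T\<in>U. high_poly s T \<and> degree T \<le> n"
      "\<forall>T. T \<notin> U \<longrightarrow> F T = (\<lambda>_. 0)" "\<forall>T. exp_poly_deg (s - 1) (F T)"
      "\<forall>z. f z = (\<Sum>T\<in>U. F T z * exp (poly T z))" by blast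
  have "f z = (\<Sum>T\<in>{T \<in> U. F T \<noteq> (\<lambda>_. 0)}. F T z * exp (poly T z))" for z
    unfolding UF(5)[rule_format] using UF(1) by (intro sum.mono_neutral_right) auto
  then show ?thesis
    using UF by (intro exI[of _ "{T \<in> U. F T \<noteq> (\<lambda>_. 0)}"] exI[of _ F]) auto
qed

section \<open>Extremal frequencies\<close>

text \<open>The positive cone of a total group order on the complex plane: lexicographic with respect to
  the directions \<open>u\<close> and \<open>\<i> * u\<close>. The second direction breaks ties, so that extremal frequencies
  are unique and the corresponding products cannot cancel.\<close>

definition cone_pos :: "complex \<Rightarrow> complex \<Rightarrow> bool" where
  "cone_pos u a \<longleftrightarrow> Re (cnj u * a) > 0 \<or> Re (cnj u * a) = 0 \<and> Im (cnj u * a) > 0"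

lemma cone_pos_add: "cone_pos u a \<Longrightarrow> cone_pos u b \<Longrightarrow> cone_pos u (a + b)"
  unfolding cone_pos_def distrib_left plus_complex.sel by linarith

lemma cone_pos_not_0: "\<not> cone_pos u 0"
  by (simp add: cone_pos_def)

lemma cone_pos_total:
  assumes "u \<noteq> 0" "a \<noteq> 0"
  shows "cone_pos u a \<or> cone_pos u (- a)"
proof -
  have "cnj u * a \<noteq> 0" using assms by simp
  then have "Re (cnj u * a) \<noteq> 0 \<or> Im (cnj u * a) \<noteq> 0" by (auto simp: complex_eq_iff)
  then show ?thesis unfolding cone_pos_def mult_minus_right uminus_complex.sel by linarith
qed

lemma cone_pos_asym: "cone_pos u a \<Longrightarrow> \<not> cone_pos u (- a)"
  using cone_pos_add[of u a "- a"] cone_pos_not_0 by auto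

lemma cone_pos_Re: "cone_pos u a \<Longrightarrow> Re (cnj u * a) \<ge> 0"
  unfolding cone_pos_def by linarith

lemma cone_le_Re: "x = y \<or> cone_pos u (y - x) \<Longrightarrow> Re (cnj u * (y - x)) \<ge> 0"
  using cone_pos_Re[of u "y - x"] by auto

lemma Re_cnj_mult_self: "Re (cnj l * l) = (cmod l)\<^sup>2"
  unfolding cmod_power2 by (simp add: power2_eq_square)

lemma cone_max_exists:
  assumes "finite X" "X \<noteq> {}" "u \<noteq> 0"
  shows "\<exists>x\<in>X. \<forall>x'\<in>X. x' = x \<or> cone_pos u (x - x')"
  using assms(1,2)
proof (induction X rule: finite_ne_induct)
  case (insert a X)
  then obtain x where x: "x \<in> X" "\<forall>x'\<in>X. x' = x \<or> cone_pos u (x - x')" by blast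
  have "a \<noteq> x" using insert x by blast
  then consider "cone_pos u (x - a)" | "cone_pos u (a - x)"
    using cone_pos_total[OF assms(3), of "x - a"] by auto
  then show ?case
  proof cases
    case 1
    then show ?thesis using x by blast
  next
    case 2
    have "cone_pos u (a - x')" if "x' \<in> X" for x'
      using x(2) that 2 cone_pos_add[OF 2, of "x - x'"] by auto
    then show ?thesis by blast
  qed
qed auto

text \<open>The derivative of g e^T is \<open>term_deriv T g\<close> times e^T: differentiation acts
  on the coefficients and leaves every exponent in place.\<close>

definition term_deriv :: "complex poly \<Rightarrow> (complex \<Rightarrow> complex) \<Rightarrow> complex \<Rightarrow> complex" where
  "term_deriv T g = (\<lambda>z. deriv g z + poly (pderiv T) z * g z)"

lemma term_deriv_zero [simp]: "term_deriv T (\<lambda>_. 0) = (\<lambda>_. 0)"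
  by (simp add: term_deriv_def)

lemma exp_poly_deg_term_deriv: "exp_poly_deg d g \<Longrightarrow> exp_poly_deg d (term_deriv T g)"
  unfolding term_deriv_def
  by (intro exp_poly_deg_add exp_poly_deg_mult exp_poly_deg_deriv exp_poly_deg_poly)

lemma small_growth_term_deriv: "s > 0 \<Longrightarrow> small_growth s g \<Longrightarrow> small_growth s (term_deriv T g)"
  unfolding term_deriv_def
  by (intro small_growth_add small_growth_mult small_growth_deriv small_growth_poly)

text \<open>The function g e^T is constant, so for non-zero \<open>T\<close> the exponential would
  be a quotient of functions of small growth. Hence the only term that is invisible in the
  derivative is the constant one.\<close>

lemma term_deriv_eq_0:
  assumes s: "s > 0" and g: "small_growth s g" and T: "high_poly s T"
    and zero: "term_deriv T g = (\<lambda>_. 0)" and nz: "g \<noteq> (\<lambda>_. 0)"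
  shows "T = 0 \<and> (\<exists>c. c \<noteq> 0 \<and> g = (\<lambda>_. c))"
proof -
  have "((\<lambda>z. g z * exp (poly T z)) has_field_derivative 0) (at z)" for z
    using exp_term_deriv[OF small_growth_holomorphic[OF g], of T z] fun_cong[OF zero, of z]
    by (simp add: term_deriv_def)
  then have "\<exists>k. \<forall>z\<in>UNIV. g z * exp (poly T z) = k"
    by (intro has_field_derivative_zero_constant) auto
  then obtain k where k: "\<And>z. g z * exp (poly T z) = k" by auto
  have "T = 0"
  proof (rule ccontr)
    assume "T \<noteq> 0"
    then have "g z = 0" for z
      by (rule no_exp_quotient[OF s g small_growth_const[OF s] T _ k])
    then show False using nz by auto
  qed
  then have "g = (\<lambda>_. k)" using k by auto
  then show ?thesis using \<open>T = 0\<close> nz by auto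
qed

lemma deriv_exp_sum:
  assumes "\<And>z. f z = (\<Sum>T\<in>U. F T z * exp (poly T z))" "\<And>T. T \<in> U \<Longrightarrow> F T holomorphic_on UNIV"
  shows "deriv f z = (\<Sum>T\<in>U. term_deriv T (F T) z * exp (poly T z))"
proof (rule DERIV_imp_deriv)
  have "f = (\<lambda>z. \<Sum>T\<in>U. F T z * exp (poly T z))" using assms(1) by auto
  then show "(f has_field_derivative (\<Sum>T\<in>U. term_deriv T (F T) z * exp (poly T z))) (at z)"
    unfolding term_deriv_def by (auto intro!: DERIV_sum exp_term_deriv assms(2))
qed

lemma sum_shift_support:
  fixes g h :: "'a :: ab_group_add \<Rightarrow> 'b :: comm_ring_1"
  assumes "finite U'" "\<And>T. T \<in> U \<Longrightarrow> T + m \<in> U'" "\<And>T. T \<notin> U \<Longrightarrow> g T = 0"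
  shows "(\<Sum>S\<in>U'. g (S - m) * h S) = (\<Sum>T\<in>U. g T * h (T + m))"
proof -
  have "(\<Sum>S\<in>U'. g (S - m) * h S) = (\<Sum>S\<in>(\<lambda>T. T + m) ` U. g (S - m) * h S)"
  proof (rule sum.mono_neutral_right)
    show "\<forall>S\<in>U' - (\<lambda>T. T + m) ` U. g (S - m) * h S = 0"
    proof
      fix S assume "S \<in> U' - (\<lambda>T. T + m) ` U"
      then have "S - m \<notin> U" by (metis DiffD2 diff_add_cancel image_eqI)
      then show "g (S - m) * h S = 0" using assms(3) by simp
    qed
  qed (use assms in auto)
  also have "\<dots> = (\<Sum>T\<in>U. g T * h (T + m))" by (subst sum.reindex) (auto simp: inj_on_def)
  finally show ?thesis .
qed

text \<open>\<open>coeff_eq\<close> is the coefficient of \<open>exp S\<close> in the differential equation for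
  \<open>f = (\<Sum>T\<in>U. F T * exp T)\<close> with \<open>A = (\<Sum>l\<in>M. G l * exp (l z\<^sup>s))\<close>. Working with these equations
  instead of with \<open>f\<close> lets one discard terms of \<open>f\<close> without leaving the setting.\<close>

locale frequency_system =
  fixes s :: nat and M :: "complex set" and G :: "complex \<Rightarrow> complex \<Rightarrow> complex"
    and B :: "complex \<Rightarrow> complex"
    and U :: "complex poly set" and F :: "complex poly \<Rightarrow> complex \<Rightarrow> complex"
  assumes s: "s > 0"
    and finM: "finite M"
    and G: "l \<in> M \<Longrightarrow> small_growth s (G l)" "l \<in> M \<Longrightarrow> G l \<noteq> (\<lambda>_. 0)"
    and finU: "finite U"
    and high: "T \<in> U \<Longrightarrow> high_poly s T"
    and F: "small_growth s (F T)"
    and F_nz: "T \<in> U \<Longrightarrow> F T \<noteq> (\<lambda>_. 0)"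
    and F_zero: "T \<notin> U \<Longrightarrow> F T = (\<lambda>_. 0)"
    and coeff_eq: "term_deriv S (term_deriv S (F S)) z + B z * F S z +
      (\<Sum>l\<in>M. G l z * term_deriv (S - monom l s) (F (S - monom l s)) z) = 0"
begin

abbreviation "Fd T \<equiv> term_deriv T (F T)"

text \<open>Frequencies are read off from f', so that a constant term does not count. That 0 is not
  among them and that no further exponents occur is proved in \<open>zero_notin_W\<close> and
  \<open>support_eq\<close>.\<close>

definition "W = {w. Fd (monom w s) \<noteq> (\<lambda>_. 0)}"

lemma Fd_outside: "T \<notin> U \<Longrightarrow> Fd T = (\<lambda>_. 0)"
  by (simp add: F_zero)

lemma small_growth_Fd: "small_growth s (Fd T)"
  by (rule small_growth_term_deriv[OF s F])

lemma finite_frequencies: "finite {x. Fd (T + monom x s) \<noteq> (\<lambda>_. 0)}"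
proof -
  have sub: "(\<lambda>x. T + monom x s) ` {x. Fd (T + monom x s) \<noteq> (\<lambda>_. 0)} \<subseteq> U"
    using Fd_outside by blast
  have "inj_on (\<lambda>x. T + monom x s) {x. Fd (T + monom x s) \<noteq> (\<lambda>_. 0)}"
    by (auto simp: inj_on_def monom_eq_iff)
  then show ?thesis by (rule finite_imageD[OF finite_subset[OF sub finU]])
qed

lemma finite_W: "finite W"
  using finite_frequencies[of 0] by (simp add: W_def)

lemma product_nonzero:
  assumes "l \<in> M" "Fd T \<noteq> (\<lambda>_. 0)"
  shows "\<exists>z. G l z * Fd T z \<noteq> 0"
  using entire_mult_eq_0[of "G l" "Fd T"] G[OF assms(1)] assms(2) small_growth_Fd
    small_growth_holomorphic by blast

text \<open>The key step. Let \<open>y\<close> be the largest frequency of \<open>A\<close> and \<open>x\<close> the largest one of \<open>f'\<close> within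
  the class of \<open>T\<close>. Nothing in \<open>f''\<close> can cancel the product of these two terms of \<open>A f'\<close>, because
  \<open>y\<close> is positive; hence it must cancel against \<open>B\<close> times a term of \<open>f\<close> with zero derivative, that is,
  the constant term.\<close>

lemma extremal_frequency:
  assumes l0: "l0 \<in> M" "Re (cnj u * l0) > 0" and T: "Fd T \<noteq> (\<lambda>_. 0)"
  shows "\<exists>y\<in>M. (\<forall>l\<in>M. l = y \<or> cone_pos u (y - l)) \<and> - y \<in> W \<and>
    (\<exists>w. T = monom w s \<and> (w = - y \<or> cone_pos u (- y - w))) \<and>
    (\<exists>c. c \<noteq> 0 \<and> F 0 = (\<lambda>_. c) \<and> (\<forall>z. B z * c + G y z * Fd (monom (- y) s) z = 0))"
proof -
  have u: "u \<noteq> 0" using l0 by auto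
  \<comment> \<open>Multiplication by \<open>A\<close> shifts exponents by multiples of z^s, so only
    exponents in the class of \<open>T\<close> modulo these multiples interact.\<close>
  define X where "X = {x. Fd (T + monom x s) \<noteq> (\<lambda>_. 0)}"
  have "0 \<in> X" using T by (simp add: X_def)
  then obtain x where x: "x \<in> X" "\<And>x'. x' \<in> X \<Longrightarrow> x' = x \<or> cone_pos u (x - x')"
    using cone_max_exists[of X u] finite_frequencies u unfolding X_def by blast
  obtain y where y: "y \<in> M" "\<forall>l\<in>M. l = y \<or> cone_pos u (y - l)"
    using cone_max_exists[OF finM _ u] l0 by blast
  have ypos: "cone_pos u y"
  proof -
    have l0pos: "cone_pos u l0" using l0 by (simp add: cone_pos_def)
    then show ?thesis using y(2) l0(1) cone_pos_add[OF l0pos, of "y - l0"] by auto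
  qed
  define S where "S = T + monom (x + y) s"
  have shift: "S - monom l s = T + monom (x + y - l) s" for l
    by (simp add: S_def add_monom[symmetric] diff_monom[symmetric])
  have sum_eq: "(\<Sum>l\<in>M. G l z * Fd (S - monom l s) z) = G y z * Fd (T + monom x s) z" for z
  proof -
    \<comment> \<open>A second product with the exponent \<open>S\<close> would need a frequency of
      f' above \<open>x\<close> or one of \<open>A\<close> above \<open>y\<close>.\<close>
    have "Fd (S - monom l s) = (\<lambda>_. 0)" if l: "l \<in> M" "l \<noteq> y" for l
    proof (rule ccontr)
      assume "Fd (S - monom l s) \<noteq> (\<lambda>_. 0)"
      then have "x + y - l \<in> X" by (simp add: X_def shift)
      then have "cone_pos u (l - y)" using x(2)[of "x + y - l"] l by (auto simp: algebra_simps)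
      moreover have "cone_pos u (y - l)" using y(2) l by auto
      ultimately show False using cone_pos_asym[of u "l - y"] by simp
    qed
    then have "(\<Sum>l\<in>M. G l z * Fd (S - monom l s) z) = (\<Sum>l\<in>{y}. G l z * Fd (S - monom l s) z)"
      using finM y(1) by (intro sum.mono_neutral_right) auto
    then show ?thesis by (simp add: shift)
  qed
  \<comment> \<open>As \<open>y\<close> is positive, x + y lies beyond the largest frequency
    \<open>x\<close>; so f' has no term at \<open>S\<close>, and neither has f''.\<close>
  have "x + y \<notin> X" using x(2)[of "x + y"] ypos cone_pos_asym[OF ypos] cone_pos_not_0 by auto
  then have FdS: "Fd S = (\<lambda>_. 0)" by (simp add: X_def S_def)
  have eq: "B z * F S z + G y z * Fd (T + monom x s) z = 0" for z
    using coeff_eq[of S z] unfolding sum_eq FdS by simp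
  have "Fd (T + monom x s) \<noteq> (\<lambda>_. 0)" using x(1) by (simp add: X_def)
  then have "F S \<noteq> (\<lambda>_. 0)" using product_nonzero[OF y(1)] eq by fastforce
  moreover have "high_poly s S" using F_zero calculation high by blast
  ultimately obtain c where c: "S = 0" "c \<noteq> 0" "F S = (\<lambda>_. c)"
    using term_deriv_eq_0[OF s F _ FdS] by blast
  \<comment> \<open>S = 0 also says that \<open>T\<close> itself is a multiple of z^s; this excludes
    exponents of degree above \<open>s\<close> in f'.\<close>
  have "T = - monom (x + y) s" using c(1) unfolding S_def by (simp only: eq_neg_iff_add_eq_0)
  then have T_eq: "T = monom (- (x + y)) s" by (simp only: minus_monom)
  have Tx: "T + monom x s = monom (- y) s" unfolding T_eq by (simp add: add_monom)
  have "- y \<in> W" using \<open>Fd (T + monom x s) \<noteq> (\<lambda>_. 0)\<close> by (simp add: W_def Tx)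
  moreover have "- (x + y) = - y \<or> cone_pos u (- y - (- (x + y)))"
    using x(2)[OF \<open>0 \<in> X\<close>] by auto
  moreover have "B z * c + G y z * Fd (monom (- y) s) z = 0" for z
    using eq[of z] c by (simp add: Tx)
  ultimately show ?thesis using y T_eq c by blast
qed

end

text \<open>If \<open>cnj l * w\<close> were not real, multiplying \<open>l\<close> by 1 + \<i> r
  would keep \<open>Re (cnj u * l)\<close> equal to |l|^2 and, for a suitable real \<open>r\<close>,
  make \<open>u\<close> orthogonal to \<open>w\<close>. The choice u = l gives the sign.\<close>

lemma opposite_direction:
  assumes "l \<noteq> 0" and neg: "\<And>u. Re (cnj u * l) > 0 \<Longrightarrow> Re (cnj u * w) < 0"
  shows "\<exists>t>0. w = complex_of_real t * (- l)"
proof -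
  define v where "v = cnj l * w"
  have ll: "cnj l * l = complex_of_real ((cmod l)\<^sup>2)"
    using complex_norm_square[of l] by (simp add: mult.commute)
  have pos: "(cmod l)\<^sup>2 > 0" using assms(1) by simp
  have Re_v: "Re v < 0" unfolding v_def by (rule neg) (use ll pos in simp)
  have "Im v = 0"
  proof (rule ccontr)
    assume Im: "Im v \<noteq> 0"
    define r where "r = - Re v / Im v"
    define u where "u = l * Complex 1 r"
    have "Re (cnj u * l) = (cmod l)\<^sup>2"
    proof -
      have "cnj u * l = Complex 1 (- r) * (cnj l * l)" by (simp add: u_def complex_eq_iff algebra_simps)
      then show ?thesis unfolding ll by simp
    qed
    moreover have "Re (cnj u * w) = 0"
    proof -
      have "cnj u * w = Complex 1 (- r) * v" by (simp add: u_def v_def complex_eq_iff algebra_simps)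
      then show ?thesis using Im by (simp add: r_def)
    qed
    ultimately show False using neg[of u] pos by simp
  qed
  then have v: "v = complex_of_real (Re v)" by (simp add: complex_eq_iff)
  have "l * v = cnj l * l * w" by (simp add: v_def mult_ac)
  then have "l * v = complex_of_real ((cmod l)\<^sup>2) * w" unfolding ll .
  then have "w = complex_of_real (- Re v / (cmod l)\<^sup>2) * (- l)"
    using v pos assms(1) by (simp add: field_simps)
  moreover have "- Re v / (cmod l)\<^sup>2 > 0" by (rule divide_pos_pos) (use Re_v pos in auto)
  ultimately show ?thesis by blast
qed

text \<open>Membership in a lattice leaves the sign of \<open>k\<close> open; the position opposite
  to \<open>b\<close>, a positive multiple of \<open>c\<close>, makes it negative.\<close>

lemma opposite_multiple:
  assumes "c \<noteq> 0" "a = of_int k * c" "b = of_nat n * c" "n > 0" "a = complex_of_real t * (- b)" "t > 0"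
  shows "\<exists>m::nat. m > 0 \<and> a = of_nat m * (- c)"
proof -
  have "of_int k * c = complex_of_real t * (- (of_nat n * c))" using assms by metis
  also have "\<dots> = complex_of_real (- t * real n) * c" by simp
  finally have "of_int k * c = complex_of_real (- t * real n) * c" .
  then have "of_int k = complex_of_real (- t * real n)"
    by (rule mult_right_cancel[THEN iffD1, OF assms(1)])
  then have "complex_of_real (real_of_int k) = complex_of_real (- t * real n)" by simp
  then have "real_of_int k = - t * real n" by (simp only: of_real_eq_iff)
  then have "k < 0" using assms(4,6) by (metis mult_neg_pos neg_less_0_iff_less of_int_less_0_iff of_nat_0_less_iff)
  then have "nat (- k) > 0" "a = of_nat (nat (- k)) * (- c)" using assms(2) by auto
  then show ?thesis by blast
qed

section \<open>From the differential equation to the coefficient equations\<close>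

lemma exp_poly_deg_0:
  assumes "exp_poly_deg 0 f"
  shows "\<exists>p. \<forall>z. f z = poly p z"
  using assms
proof induction
  case zero
  show ?case by (rule exI[of _ 0]) simp
next
  case (add_term Q g P)
  obtain p where p: "\<forall>z. g z = poly p z" using add_term.IH by blast
  obtain a where "Q = [:a:]" using add_term(1) by (auto elim: degree_eq_zeroE)
  then show ?case using p by (intro exI[of _ "smult (exp a) P + p"]) simp
qed

text \<open>With \<open>s\<close> the least bound for the degrees of the exponents, some frequency
  is non-zero: otherwise \<open>A\<close> would have exponents of degree at most s - 1.
  \<open>M\<close> may contain 0; then \<open>G 0\<close> is the multiplier F_0 of the normalized
  form.\<close>

lemma exp_poly_leading_form:
  assumes "exp_poly A" "transcendental_fun A"
  obtains s M G where "s > 0" "exp_poly_deg s A" "finite M" "\<exists>l\<in>M. l \<noteq> 0"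
    "\<forall>l\<in>M. G l \<noteq> (\<lambda>_. 0)" "\<forall>l. exp_poly_deg (s - 1) (G l)"
    "\<forall>z. A z = (\<Sum>l\<in>M. G l z * exp (poly (monom l s) z))"
proof -
  define s where "s = (LEAST d. exp_poly_deg d A)"
  have A: "exp_poly_deg s A"
    unfolding s_def using exp_poly_imp_exp_poly_deg[OF assms(1)] by (rule LeastI_ex)
  have least: "\<not> exp_poly_deg d A" if "d < s" for d
    using not_less_Least[of d "\<lambda>d. exp_poly_deg d A"] that by (simp add: s_def)
  have s: "s > 0" using exp_poly_deg_0 A assms(2) unfolding transcendental_fun_def
    by (cases "s = 0") auto
  obtain V H where VH: "finite V" "\<forall>T\<in>V. high_poly s T \<and> degree T \<le> s \<and> H T \<noteq> (\<lambda>_. 0)"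
      "\<forall>T. exp_poly_deg (s - 1) (H T)" "\<forall>z. A z = (\<Sum>T\<in>V. H T z * exp (poly T z))"
    using exp_poly_decomposition[OF A s] by blast
  have V: "T = monom (coeff T s) s" if "T \<in> V" for T
  proof (rule poly_eqI)
    fix i
    have "high_poly s T" "degree T \<le> s" using VH(2) that by auto
    then show "coeff T i = coeff (monom (coeff T s) s) i"
      by (cases i s rule: linorder_cases) (auto simp: high_poly_def coeff_eq_0)
  qed
  define M where "M = (\<lambda>T. coeff T s) ` V"
  have V_eq: "V = (\<lambda>l. monom l s) ` M"
    using V unfolding M_def image_image by (metis (no_types, lifting) image_cong image_ident)
  have A_eq: "\<forall>z. A z = (\<Sum>l\<in>M. H (monom l s) z * exp (poly (monom l s) z))"
    using VH(4) unfolding V_eq by (simp add: sum.reindex inj_on_def monom_eq_iff)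
  have "\<exists>l\<in>M. l \<noteq> 0"
  proof (rule ccontr)
    assume "\<not> (\<exists>l\<in>M. l \<noteq> 0)"
    then have "M \<subseteq> {0}" by auto
    then have "A = (\<lambda>z. \<Sum>l\<in>M. H (monom l s) z)"
      using A_eq by (auto simp: fun_eq_iff poly_monom intro!: sum.cong)
    moreover have "exp_poly_deg (s - 1) (\<lambda>z. \<Sum>l\<in>M. H (monom l s) z)"
      using VH(3) by (intro exp_poly_deg_sum) auto
    ultimately show False using least[of "s - 1"] s by simp
  qed
  moreover have "\<forall>l\<in>M. H (monom l s) \<noteq> (\<lambda>_. 0)"
    using VH(2) V_eq by blast
  moreover have "finite M" using VH(1) by (simp add: M_def)
  ultimately show ?thesis
    using that[OF s A _ _ _ _ A_eq] VH(3) by blast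
qed

text \<open>\<open>U'\<close> contains every exponent that occurs in the equation. There,
  independence gives K S = 0; for any other \<open>S\<close> each summand vanishes because
  \<open>F\<close> is zero off \<open>U\<close>. So the coefficient equations hold for all
  \<open>S\<close>.\<close>

lemma frequency_system_of_ode:
  assumes s: "s > 0" and finM: "finite M"
    and G: "\<And>l. l \<in> M \<Longrightarrow> small_growth s (G l)" "\<And>l. l \<in> M \<Longrightarrow> G l \<noteq> (\<lambda>_. 0)"
    and A: "\<And>z. A z = (\<Sum>l\<in>M. G l z * exp (poly (monom l s) z))"
    and B: "small_growth s B"
    and finU: "finite U" and high: "\<And>T. T \<in> U \<Longrightarrow> high_poly s T"
    and F: "\<And>T. small_growth s (F T)" "\<And>T. T \<in> U \<Longrightarrow> F T \<noteq> (\<lambda>_. 0)" "\<And>T. T \<notin> U \<Longrightarrow> F T = (\<lambda>_. 0)"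
    and f: "\<And>z. f z = (\<Sum>T\<in>U. F T z * exp (poly T z))"
    and ode: "\<And>z. deriv (deriv f) z + A z * deriv f z + B z * f z = 0"
  shows "frequency_system s M G B U F"
proof
  fix S z
  define Fd where "Fd = (\<lambda>T. term_deriv T (F T))"
  define Fdd where "Fdd = (\<lambda>T. term_deriv T (Fd T))"
  define K where "K = (\<lambda>S z. Fdd S z + B z * F S z + (\<Sum>l\<in>M. G l z * Fd (S - monom l s) z))"
  have Fd_sg: "small_growth s (Fd T)" for T unfolding Fd_def by (rule small_growth_term_deriv[OF s F(1)])
  have Fdd_sg: "small_growth s (Fdd T)" for T unfolding Fdd_def by (rule small_growth_term_deriv[OF s Fd_sg])
  have Fd_out: "Fd T = (\<lambda>_. 0)" and Fdd_out: "Fdd T = (\<lambda>_. 0)" if "T \<notin> U" for T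
    using F(3)[OF that] by (simp_all add: Fd_def Fdd_def)
  have f': "deriv f z = (\<Sum>T\<in>U. Fd T z * exp (poly T z))" for z
    unfolding Fd_def using F(1) by (intro deriv_exp_sum f small_growth_holomorphic)
  have f'': "deriv (deriv f) z = (\<Sum>T\<in>U. Fdd T z * exp (poly T z))" for z
    unfolding Fdd_def using Fd_sg by (intro deriv_exp_sum f' small_growth_holomorphic)
  define U' where "U' = U \<union> (\<Union>l\<in>M. (\<lambda>T. T + monom l s) ` U)"
  have finU': "finite U'" using finM finU by (simp add: U'_def)
  have U': "U \<subseteq> U'" "\<And>l T. l \<in> M \<Longrightarrow> T \<in> U \<Longrightarrow> T + monom l s \<in> U'" by (auto simp: U'_def)
  have highU': "high_poly s T" if "T \<in> U'" for T
    using that high by (auto simp: U'_def intro: high_poly_add high_poly_monom)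
  have K_sg: "small_growth s (K S)" for S
    unfolding K_def
    by (intro small_growth_add small_growth_mult small_growth_sum s Fdd_sg Fd_sg B F(1) G(1))
  have K_sum: "(\<Sum>S\<in>U'. K S z * exp (poly S z)) = 0" for z
  proof -
    have 1: "(\<Sum>S\<in>U'. Fdd S z * exp (poly S z)) = deriv (deriv f) z"
      unfolding f'' using finU' U'(1) by (intro sum.mono_neutral_right) (auto simp: Fdd_out)
    have 2: "(\<Sum>S\<in>U'. F S z * exp (poly S z)) = f z"
      unfolding f using finU' U'(1) F(3) by (intro sum.mono_neutral_right) auto
    have 3: "(\<Sum>S\<in>U'. Fd (S - monom l s) z * exp (poly S z)) = exp (poly (monom l s) z) * deriv f z"
      if l: "l \<in> M" for l
    proof -
      have "(\<Sum>S\<in>U'. Fd (S - monom l s) z * exp (poly S z)) =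
          (\<Sum>T\<in>U. Fd T z * exp (poly (T + monom l s) z))"
        using finU' U'(2)[OF l] by (intro sum_shift_support[where g = "\<lambda>T. Fd T z"]) (simp_all add: Fd_out)
      also have "\<dots> = exp (poly (monom l s) z) * deriv f z"
        unfolding f' sum_distrib_left by (intro sum.cong) (auto simp: exp_add algebra_simps)
      finally show ?thesis .
    qed
    have "(\<Sum>S\<in>U'. K S z * exp (poly S z)) = (\<Sum>S\<in>U'. Fdd S z * exp (poly S z))
        + B z * (\<Sum>S\<in>U'. F S z * exp (poly S z))
        + (\<Sum>S\<in>U'. \<Sum>l\<in>M. G l z * (Fd (S - monom l s) z * exp (poly S z)))"
      unfolding K_def by (simp add: distrib_right sum.distrib sum_distrib_left sum_distrib_right mult.assoc)
    also have "(\<Sum>S\<in>U'. \<Sum>l\<in>M. G l z * (Fd (S - monom l s) z * exp (poly S z))) =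
        (\<Sum>l\<in>M. G l z * (\<Sum>S\<in>U'. Fd (S - monom l s) z * exp (poly S z)))"
      by (subst sum.swap) (simp add: sum_distrib_left)
    also have "\<dots> = A z * deriv f z"
      unfolding A sum_distrib_right using 3 by (intro sum.cong) auto
    also have "(\<Sum>S\<in>U'. Fdd S z * exp (poly S z)) + B z * (\<Sum>S\<in>U'. F S z * exp (poly S z)) + A z * deriv f z = 0"
      unfolding 1 2 using ode[of z] by (simp add: algebra_simps)
    finally show ?thesis .
  qed
  have "K S z = 0"
  proof (cases "S \<in> U'")
    case True
    show ?thesis by (rule exp_independent[OF s finU' highU' K_sg K_sum True])
  next
    case False
    have "S - monom l s \<notin> U" if "l \<in> M" for l
      using U'(2)[OF that, of "S - monom l s"] False by auto
    moreover have "S \<notin> U" using False U'(1) by blast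
    ultimately show ?thesis by (simp add: K_def Fd_out Fdd_out F(3))
  qed
  then show "term_deriv S (term_deriv S (F S)) z + B z * F S z +
      (\<Sum>l\<in>M. G l z * term_deriv (S - monom l s) (F (S - monom l s)) z) = 0"
    by (simp add: K_def Fdd_def Fd_def)
qed (use assms in auto)

section \<open>Duality and lattices of frequencies\<close>

context frequency_system
begin

text \<open>In the order of the cone, l <= y and w <= -y for the extremal \<open>y\<close>; taking
  real parts, the value at \<open>w\<close> is at most minus the value at \<open>l\<close>.\<close>

lemma frequency_sign:
  assumes "l \<in> M" "Re (cnj u * l) > 0" "w \<in> W"
  shows "Re (cnj u * w) < 0"
proof -
  have "Fd (monom w s) \<noteq> (\<lambda>_. 0)" using assms(3) by (simp add: W_def)
  from extremal_frequency[OF assms(1,2) this]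
  obtain y where y: "l = y \<or> cone_pos u (y - l)" "w = - y \<or> cone_pos u (- y - w)"
    using assms(1) by (auto simp: monom_eq_iff)
  have "Re (cnj u * (y - l)) \<ge> 0" using y(1) by (rule cone_le_Re)
  moreover have "Re (cnj u * (- y - w)) \<ge> 0" using y(2) by (rule cone_le_Re)
  ultimately show ?thesis using assms(2) unfolding right_diff_distrib mult_minus_right by simp
qed

lemma frequencies_opposite:
  assumes "l \<in> M" "l \<noteq> 0" "w \<in> W"
  shows "\<exists>t>0. w = complex_of_real t * (- l)"
  using assms frequency_sign by (intro opposite_direction) auto

lemma zero_notin_W:
  assumes "l \<in> M" "l \<noteq> 0"
  shows "0 \<notin> W"
  using frequencies_opposite[OF assms, of 0] assms(2) by auto

text \<open>A term with zero derivative is the constant one; every other exponent has the form w z^s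
  by \<open>extremal_frequency\<close>. So no exponent of \<open>f\<close> has degree above
  \<open>s\<close>.\<close>

lemma support_eq:
  assumes "l \<in> M" "l \<noteq> 0" "F 0 \<noteq> (\<lambda>_. 0)"
  shows "U = insert 0 ((\<lambda>w. monom w s) ` W)"
proof
  have "Re (cnj l * l) > 0" using assms(2) by (simp add: Re_cnj_mult_self del: times_complex.sel)
  show "U \<subseteq> insert 0 ((\<lambda>w. monom w s) ` W)"
  proof
    fix T assume T: "T \<in> U"
    show "T \<in> insert 0 ((\<lambda>w. monom w s) ` W)"
    proof (cases "Fd T = (\<lambda>_. 0)")
      case True
      then show ?thesis using term_deriv_eq_0[OF s F high[OF T] _ F_nz[OF T]] by simp
    next
      case False
      then obtain w where "T = monom w s"
        using extremal_frequency[OF assms(1) \<open>Re (cnj l * l) > 0\<close> False] by blast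
      then show ?thesis using False by (auto simp: W_def)
    qed
  qed
  show "insert 0 ((\<lambda>w. monom w s) ` W) \<subseteq> U"
    using assms(3) F_zero Fd_outside by (auto simp: W_def)
qed

text \<open>Take the largest frequency \<open>x\<close> of f' and the largest frequency
  \<open>y\<close> of \<open>A\<close> off the lattice. Their product has an exponent off the
  lattice, where neither f nor f'' has a term. Any other pair with this exponent again involves a
  frequency of \<open>A\<close> off the lattice, so maximality excludes it. The cone for u = 1 is
  just one choice of a total order.\<close>

lemma coefficient_frequencies_in_lattice:
  assumes "l \<in> M" "l \<noteq> 0" "F 0 \<noteq> (\<lambda>_. 0)" "W \<noteq> {}"
    and W: "\<And>w. w \<in> W \<Longrightarrow> \<exists>k. w = of_int k * c" and "l' \<in> M"
  shows "\<exists>k. l' = of_int k * c"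
proof (rule ccontr)
  assume l': "\<not> (\<exists>k. l' = of_int k * c)"
  define M2 where "M2 = {l \<in> M. \<not> (\<exists>k. l = of_int k * c)}"
  have "finite M2" "M2 \<noteq> {}" using finM l' \<open>l' \<in> M\<close> by (auto simp: M2_def)
  then obtain y where y: "y \<in> M2" "\<forall>l\<in>M2. l = y \<or> cone_pos 1 (y - l)"
    using cone_max_exists[of M2 1] by auto
  obtain x where x: "x \<in> W" "\<forall>x'\<in>W. x' = x \<or> cone_pos 1 (x - x')"
    using cone_max_exists[OF finite_W \<open>W \<noteq> {}\<close>, of 1] by auto
  obtain kx where kx: "x = of_int kx * c" using W x(1) by blast
  define S where "S = monom (x + y) s"
  have shift: "S - monom l s = monom (x + y - l) s" for l by (simp add: S_def diff_monom)
  have not_lattice: "x + y \<noteq> of_int k * c" for k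
  proof
    assume "x + y = of_int k * c"
    then have "y = of_int (k - kx) * c" using kx by (simp add: algebra_simps)
    then show False using y(1) unfolding M2_def by blast
  qed
  have "S \<notin> U"
  proof
    assume "S \<in> U"
    then have "x + y = 0 \<or> x + y \<in> W"
      unfolding support_eq[OF assms(1-3)] S_def by (auto simp: monom_eq_iff monom_eq_0_iff)
    then show False using not_lattice[of 0] W not_lattice by auto
  qed
  then have S0: "F S = (\<lambda>_. 0)" by (rule F_zero)
  have "Fd (S - monom l s) = (\<lambda>_. 0)" if l: "l \<in> M" "l \<noteq> y" for l
  proof (rule ccontr)
    assume "Fd (S - monom l s) \<noteq> (\<lambda>_. 0)"
    then have w: "x + y - l \<in> W" by (simp add: W_def shift)
    then obtain k where k: "x + y - l = of_int k * c" using W by blast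
    have "l \<in> M2"
    proof (rule ccontr)
      assume "l \<notin> M2"
      then obtain j where "l = of_int j * c" using l by (auto simp: M2_def)
      then show False using not_lattice[of "k + j"] k by (simp add: algebra_simps)
    qed
    then have "cone_pos 1 (y - l)" using y(2) l by auto
    moreover have "cone_pos 1 (l - y)" using x(2) w l by (auto simp: algebra_simps)
    ultimately show False using cone_pos_asym[of 1 "l - y"] by simp
  qed
  then have "(\<Sum>l\<in>M. G l z * Fd (S - monom l s) z) = (\<Sum>l\<in>{y}. G l z * Fd (S - monom l s) z)" for z
    using finM y(1) by (intro sum.mono_neutral_right) (auto simp: M2_def)
  then have "G y z * Fd (monom x s) z = 0" for z
    using coeff_eq[of S z] by (simp add: S0 shift)
  moreover have "y \<in> M" "Fd (monom x s) \<noteq> (\<lambda>_. 0)" using y(1) x(1) by (auto simp: M2_def W_def)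
  ultimately show False using product_nonzero by blast
qed

text \<open>The terms of the solution with frequencies outside the lattice form a solution without
  constant term, which is impossible unless there are no such terms.\<close>

lemma solution_frequencies_in_lattice:
  assumes l: "l \<in> M" "l \<noteq> 0"
    and M: "\<And>l. l \<in> M \<Longrightarrow> \<exists>k. l = of_int k * c" and w: "w \<in> W"
  shows "\<exists>k. w = of_int k * c"
proof (rule ccontr)
  assume w': "\<not> (\<exists>k. w = of_int k * c)"
  define \<Lambda> where "\<Lambda> = range (\<lambda>k. monom (of_int k * c) s)"
  define F2 where "F2 = (\<lambda>T. if T \<in> \<Lambda> then (\<lambda>_. 0) else F T)"
  \<comment> \<open>As the frequencies of \<open>A\<close> lie in the lattice, the equation at
    \<open>S\<close> involves only exponents on the same side of \<Lambda> as \<open>S\<close>; the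
    two parts of the solution satisfy the equations separately.\<close>
  have shift: "S - monom l s \<in> \<Lambda> \<longleftrightarrow> S \<in> \<Lambda>" if "l \<in> M" for l S
  proof -
    obtain j where j: "l = of_int j * c" using M[OF \<open>l \<in> M\<close>] by blast
    have "S - monom l s = monom (of_int k * c) s \<longleftrightarrow> S = monom (of_int (k + j) * c) s" for k
      by (simp add: j distrib_right diff_eq_eq flip: add_monom)
    moreover have "S = monom (of_int k * c) s \<longleftrightarrow> S - monom l s = monom (of_int (k - j) * c) s" for k
      by (simp add: j left_diff_distrib flip: diff_monom)
    ultimately show ?thesis unfolding \<Lambda>_def by blast
  qed
  interpret F2: frequency_system s M G B "U - \<Lambda>" F2
  proof
    fix S z
    show "term_deriv S (term_deriv S (F2 S)) z + B z * F2 S z +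
        (\<Sum>l\<in>M. G l z * term_deriv (S - monom l s) (F2 (S - monom l s)) z) = 0"
      using coeff_eq[of S z] by (cases "S \<in> \<Lambda>") (simp_all add: F2_def shift)
  qed (use s finM G finU high F F_nz F_zero small_growth_const[OF s] in \<open>auto simp: F2_def\<close>)
  have "monom w s \<notin> \<Lambda>" using w' by (auto simp: \<Lambda>_def monom_eq_iff)
  then have "term_deriv (monom w s) (F2 (monom w s)) \<noteq> (\<lambda>_. 0)"
    using w by (simp add: F2_def W_def)
  moreover have "Re (cnj l * l) > 0" using l(2) by (simp add: Re_cnj_mult_self del: times_complex.sel)
  ultimately obtain b where "b \<noteq> 0" "F2 0 = (\<lambda>_. b)"
    using F2.extremal_frequency[OF l(1)] by blast
  moreover have "0 \<in> \<Lambda>" unfolding \<Lambda>_def by (rule image_eqI[of _ _ 0]) auto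
  ultimately show False by (auto simp: F2_def dest: fun_cong)
qed

end

text \<open>Were the order smaller, \<open>f\<close> itself would be an admissible coefficient, and
  subtracting it would give a relation between exponentials with the non-zero coefficient
  \<open>H l\<close>.\<close>

lemma entire_order_exp_sum:
  assumes s: "s > 0" and fin: "finite X"
    and H: "\<And>l. l \<in> X \<Longrightarrow> exp_poly_deg (s - 1) (H l)"
    and l: "l \<in> X" "l \<noteq> 0" "H l \<noteq> (\<lambda>_. 0)"
    and f: "\<And>z. f z = (\<Sum>l\<in>X. H l z * exp (poly (monom l s) z))"
  shows "entire_order f = ereal (real s)"
proof (rule antisym)
  have f_eq: "f = (\<lambda>z. \<Sum>l\<in>X. H l z * exp (poly (monom l s) z))" using f by auto
  have exp_term: "exp_poly_deg s (\<lambda>z. exp (poly (monom l s) z))" for l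
    using exp_poly_deg_term[of "monom l s" s 1] by (simp add: degree_monom_le)
  have f_deg: "exp_poly_deg s f"
    unfolding f_eq
    by (intro exp_poly_deg_sum exp_poly_deg_mult exp_term exp_poly_deg_mono[OF H]) auto
  then show "entire_order f \<le> ereal (real s)" by (rule entire_order_le)
  show "ereal (real s) \<le> entire_order f"
  proof (rule ccontr)
    assume "\<not> ereal (real s) \<le> entire_order f"
    then have f_sg: "small_growth s f"
      using small_growth_if_entire_order_less exp_poly_deg_holomorphic[OF f_deg] by simp
    have H_sg: "small_growth s (H l)" if "l \<in> X" for l
      using exp_poly_deg_small_growth[OF H[OF that]] s by simp
    define Y where "Y = (\<lambda>l. monom l s) ` X"
    \<comment> \<open>\<open>f\<close> is subtracted at the exponent 0, where a term
      \<open>H 0\<close> may already stand; the coefficient at the non-zero exponent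
      \<open>monom l s\<close> remains \<open>H l\<close>.\<close>
    define C where "C = (\<lambda>T z. (if T \<in> Y then H (coeff T s) z else 0) - (if T = 0 then f z else 0))"
    have "C (monom l s) z = 0" for z
    proof (rule exp_independent[OF s, where U = "insert 0 Y" and C = C])
      show "finite (insert 0 Y)" using fin by (simp add: Y_def)
      show "high_poly s T" if "T \<in> insert 0 Y" for T
        using that by (auto simp: Y_def high_poly_0 high_poly_monom)
      show "small_growth s (C T)" for T
      proof -
        have "small_growth s (\<lambda>z. if T \<in> Y then H (coeff T s) z else 0)"
          using H_sg small_growth_const[OF s] by (cases "T \<in> Y") (auto simp: Y_def)
        moreover have "small_growth s (\<lambda>z. if T = 0 then f z else 0)"
          using f_sg small_growth_const[OF s] by (cases "T = 0") auto
        ultimately show ?thesis unfolding C_def by (rule small_growth_diff[OF s])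
      qed
      show "monom l s \<in> insert 0 Y" using l by (simp add: Y_def)
      fix z
      have "(\<Sum>T\<in>insert 0 Y. C T z * exp (poly T z)) =
          (\<Sum>T\<in>insert 0 Y. if T \<in> Y then H (coeff T s) z * exp (poly T z) else 0)
          - (\<Sum>T\<in>insert 0 Y. if T = 0 then f z else 0)"
        unfolding sum_subtractf[symmetric] by (intro sum.cong) (auto simp: C_def algebra_simps)
      also have "(\<Sum>T\<in>insert 0 Y. if T \<in> Y then H (coeff T s) z * exp (poly T z) else 0)
          = (\<Sum>T\<in>Y. H (coeff T s) z * exp (poly T z))"
        using fin by (intro sum.mono_neutral_cong_right) (auto simp: Y_def)
      also have "\<dots> = f z"
        unfolding f Y_def by (subst sum.reindex) (auto simp: inj_on_def monom_eq_iff)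
      also have "(\<Sum>T\<in>insert 0 Y. if T = 0 then f z else 0) = f z"
        using fin by (subst sum.delta) (auto simp: Y_def)
      finally show "(\<Sum>T\<in>insert 0 Y. C T z * exp (poly T z)) = 0" by simp
    qed
    then have "H l = (\<lambda>_. 0)" using l(1,2) by (auto simp: C_def Y_def monom_eq_0_iff)
    then show False using l(3) by simp
  qed
qed

text \<open>A single \<open>w0\<close> aligns all of \<open>L\<close>: each element is opposite to
  \<open>w0\<close> and hence lies on the ray of \<open>l0\<close>.\<close>

lemma dual_freqs_if_opposite:
  assumes w0: "w0 \<in> W" and l0: "l0 \<in> L" "l0 \<noteq> 0"
    and opp: "\<And>w l. w \<in> W \<Longrightarrow> l \<in> L \<Longrightarrow> \<exists>t>0. w = complex_of_real t * (- l)"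
  shows "dual_freqs W L"
proof -
  define r where "r = cmod l0"
  have r: "r > 0" "l0 = complex_of_real r * sgn l0"
    using l0 by (auto simp: r_def sgn_div_norm scaleR_conv_of_real)
  obtain t0 where t0: "t0 > 0" "w0 = complex_of_real t0 * (- l0)" using opp[OF w0 l0(1)] by blast
  show ?thesis
    unfolding dual_freqs_def
  proof (intro exI[of _ "- sgn l0"] conjI ballI)
    show "cmod (- sgn l0) = 1" using l0 by (simp add: norm_sgn)
    show "\<exists>t>0. w = complex_of_real t * (- sgn l0)" if w: "w \<in> W" for w
    proof -
      obtain t where t: "t > 0" "w = complex_of_real t * (- l0)" using opp[OF w l0(1)] by blast
      have "w = complex_of_real (t * r) * (- sgn l0)"
        unfolding t(2) by (subst r(2)) simp
      then show ?thesis using t r by (intro exI[of _ "t * r"]) auto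
    qed
    show "\<exists>t>0. l = complex_of_real t * (- (- sgn l0))" if l: "l \<in> L" for l
    proof -
      obtain t where t: "t > 0" "w0 = complex_of_real t * (- l)" using opp[OF w0 l] by blast
      have "complex_of_real t * l = complex_of_real t0 * l0" using t(2) t0(2) by simp
      then have "l = complex_of_real (t0 / t) * l0" using t(1) by (simp add: field_simps)
      also have "\<dots> = complex_of_real (t0 / t * r) * sgn l0" by (subst r(2)) simp
      finally show ?thesis using t t0 r by (intro exI[of _ "t0 / t * r"]) auto
    qed
  qed
qed

theorem theorem3p1:
  fixes f A B :: "complex \<Rightarrow> complex"
  assumes "A holomorphic_on UNIV" and "B holomorphic_on UNIV"
    and "f holomorphic_on UNIV"
    and "\<forall>z. deriv (deriv f) z + A z * deriv f z + B z * f z = 0"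
    and "exp_poly f" and "transcendental_fun f"
    and "exp_poly A" and "transcendental_fun A"
    and "(\<lambda>r. nev_T B r) \<in> o[at_top](\<lambda>r. nev_T A r)"
  shows "\<exists>q::nat. q \<ge> 1 \<and> entire_order f = ereal (real q) \<and> entire_order A = ereal (real q) \<and>
     (\<exists>c W F A0 L G. c \<noteq> 0 \<and>
        normalized_rep q f (\<lambda>_. c) W F \<and> normalized_rep q A A0 L G \<and>
        dual_freqs W L \<and>
        exp_poly B \<and> entire_order B \<le> ereal (real q - 1) \<and>
        (commensurable W \<longleftrightarrow> commensurable L) \<and>
        (commensurable W \<longrightarrow> strongly_dual_freqs W L))"
proof -
  obtain s M G where s: "s > 0" and A_deg: "exp_poly_deg s A" and finM: "finite M"
    and M_nz: "\<exists>l\<in>M. l \<noteq> 0" and G_nz: "\<forall>l\<in>M. G l \<noteq> (\<lambda>_. 0)"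
    and G_deg: "\<forall>l. exp_poly_deg (s - 1) (G l)"
    and A_eq: "\<forall>z. A z = (\<Sum>l\<in>M. G l z * exp (poly (monom l s) z))"
    by (rule exp_poly_leading_form[OF assms(7,8)])
  obtain C where C: "C \<ge> 0" "\<And>z. cmod z \<ge> 1 \<Longrightarrow> cmod (A z) \<le> exp (C * cmod z ^ s)"
    using exp_poly_deg_exp_bound[OF A_deg s] by blast
  have B_sg: "small_growth s B"
    using small_growth_if_nev_T_smallo[OF s assms(1,2) C assms(9)] .
  obtain n where f_deg: "exp_poly_deg n f" using exp_poly_imp_exp_poly_deg[OF assms(5)] by blast
  obtain U F where finU: "finite U"
    and U: "\<forall>T\<in>U. high_poly s T \<and> degree T \<le> n \<and> F T \<noteq> (\<lambda>_. 0)"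
    and F_zero: "\<forall>T. T \<notin> U \<longrightarrow> F T = (\<lambda>_. 0)"
    and F_deg: "\<forall>T. exp_poly_deg (s - 1) (F T)"
    and f_eq: "\<forall>z. f z = (\<Sum>T\<in>U. F T z * exp (poly T z))"
    using exp_poly_decomposition[OF f_deg s] by blast
  have sg: "small_growth s g" if "exp_poly_deg (s - 1) g" for g
    using exp_poly_deg_small_growth[OF that] s by simp
  interpret frequency_system s M G B U F
    by (rule frequency_system_of_ode[of s M G A B U F f])
       (use s finM G_nz A_eq B_sg finU U F_zero f_eq assms(4) sg G_deg F_deg in auto)
  \<comment> \<open>If every term had zero derivative, \<open>f\<close> would be constant and so not
    transcendental.\<close>
  obtain T0 where T0: "Fd T0 \<noteq> (\<lambda>_. 0)"
  proof (rule ccontr)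
    assume "\<not> thesis"
    then have Fd0: "Fd T = (\<lambda>_. 0)" for T using that by blast
    have U0: "T = 0 \<and> (\<exists>c. F T = (\<lambda>_. c))" if "T \<in> U" for T
      using term_deriv_eq_0[OF s F high[OF that] Fd0 F_nz[OF that]] by blast
    then have "U \<subseteq> {0}" by blast
    then have "f z = F 0 z" for z
      using F_zero f_eq by (cases "U = {}") (auto simp: subset_singleton_iff)
    moreover obtain c where "F 0 = (\<lambda>_. c)" using U0 F_zero by (cases "0 \<in> U") auto
    ultimately have "\<forall>z. f z = poly [:c:] z" by simp
    then show False using assms(6) unfolding transcendental_fun_def by blast
  qed
  obtain l0 where l0: "l0 \<in> M" "l0 \<noteq> 0" using M_nz by blast
  have l0_pos: "(cmod l0)\<^sup>2 > 0" using l0 by simp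
  have Re_l0: "Re (cnj l0 * l0) > 0" unfolding Re_cnj_mult_self by (rule l0_pos)
  have Re_mult: "Re (cnj l0 * (complex_of_real t * l0)) = t * (cmod l0)\<^sup>2" for t
  proof -
    have "cnj l0 * (complex_of_real t * l0) = complex_of_real t * (cnj l0 * l0)" by (simp add: mult_ac)
    also have "Re \<dots> = t * Re (cnj l0 * l0)" by simp
    finally show ?thesis unfolding Re_cnj_mult_self .
  qed
  obtain y c where y: "y \<in> M" "\<forall>l\<in>M. l = y \<or> cone_pos l0 (y - l)" "- y \<in> W"
    and c: "c \<noteq> 0" "F 0 = (\<lambda>_. c)" "\<forall>z. B z * c + G y z * Fd (monom (- y) s) z = 0"
    using extremal_frequency[OF l0(1) Re_l0 T0] by blast
  have F0_nz: "F 0 \<noteq> (\<lambda>_. 0)" using c by (auto dest: fun_cong)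
  \<comment> \<open>\<open>extremal_frequency\<close> supplies a maximum for each \<open>w\<close>
    separately; antisymmetry of the cone identifies it with \<open>y\<close>.\<close>
  have W_max: "w = - y \<or> cone_pos l0 (- y - w)" if "w \<in> W" for w
  proof -
    have "Fd (monom w s) \<noteq> (\<lambda>_. 0)" using that by (simp add: W_def)
    from extremal_frequency[OF l0(1) Re_l0 this] obtain y' where
      y': "y' \<in> M" "\<forall>l\<in>M. l = y' \<or> cone_pos l0 (y' - l)" "w = - y' \<or> cone_pos l0 (- y' - w)"
      by (auto simp: monom_eq_iff)
    have "y' = y"
    proof (rule ccontr)
      assume "y' \<noteq> y"
      then have "cone_pos l0 (y - y')" using y(2) y'(1) by blast
      moreover have "cone_pos l0 (y' - y)" using bspec[OF y'(2) y(1)] \<open>y' \<noteq> y\<close> by auto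
      ultimately show False using cone_pos_asym[of l0 "y - y'"] by simp
    qed
    then show ?thesis using y'(3) by simp
  qed
  define L where "L = M - {0}"
  have W0: "0 \<notin> W" by (rule zero_notin_W[OF l0])
  have "y \<in> L" using y W0 by (auto simp: L_def)
  have opp: "\<exists>t>0. w = complex_of_real t * (- l)" if "w \<in> W" "l \<in> L" for w l
    using frequencies_opposite that by (auto simp: L_def)
  have dual: "dual_freqs W L"
    by (rule dual_freqs_if_opposite[OF y(3), of l0]) (use l0 opp in \<open>auto simp: L_def\<close>)
  have f_eq': "f z = (\<Sum>w\<in>insert 0 W. F (monom w s) z * exp (poly (monom w s) z))" for z
  proof -
    have "U = (\<lambda>w. monom w s) ` insert 0 W" using support_eq[OF l0 F0_nz] by simp
    moreover have "inj_on (\<lambda>w. monom w s) (insert 0 W)" by (simp add: inj_on_def monom_eq_iff)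
    ultimately show ?thesis using f_eq by (simp only: sum.reindex o_def)
  qed
  have order_le: "entire_order g \<le> ereal (real s - 1)" if "exp_poly_deg (s - 1) g" for g
    using entire_order_le[OF that] s by (simp add: of_nat_diff)
  have ep_le: "exp_poly g \<and> entire_order g \<le> ereal (real s - 1)" if "exp_poly_deg (s - 1) g" for g
    using exp_poly_deg_imp_exp_poly[OF that] order_le[OF that] by simp
  have f_rep: "normalized_rep s f (\<lambda>_. c) W (\<lambda>w. F (monom w s))"
    unfolding normalized_rep_def
  proof (intro conjI ballI allI)
    show "F (monom w s) \<noteq> (\<lambda>_. 0)" if "w \<in> W" for w using that by (auto simp: W_def)
    show "f z = c + (\<Sum>w\<in>W. F (monom w s) z * exp (w * z ^ s))" for z
      unfolding f_eq' using finite_W W0 c(2) by (simp add: poly_monom)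
  qed (use s finite_W y(3) W0 ep_le[OF F_deg[rule_format]] ep_le[OF exp_poly_deg_const] in auto)
  define A0 where "A0 = (if 0 \<in> M then G 0 else (\<lambda>_. 0))"
  have A_rep: "normalized_rep s A A0 L G"
    unfolding normalized_rep_def
  proof (intro conjI ballI allI)
    show "A z = A0 z + (\<Sum>w\<in>L. G w z * exp (w * z ^ s))" for z
      unfolding A_eq[rule_format] L_def A0_def using finM by (simp add: poly_monom sum.remove)
    show "exp_poly A0" "entire_order A0 \<le> ereal (real s - 1)"
      using ep_le[OF G_deg[rule_format]] ep_le[OF exp_poly_deg.zero] by (auto simp: A0_def)
  qed (use s finM l0 G_nz ep_le[OF G_deg[rule_format]] in \<open>auto simp: L_def\<close>)
  have order_f: "entire_order f = ereal (real s)"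
    by (rule entire_order_exp_sum[OF s _ _ _ _ _ f_eq', of "- y"])
       (use finite_W F_deg y W0 in \<open>auto simp: W_def\<close>)
  have order_A: "entire_order A = ereal (real s)"
    by (rule entire_order_exp_sum[OF s finM _ _ _ _ A_eq[rule_format], of l0]) (use G_deg l0 G_nz in auto)
  have B_deg: "exp_poly_deg (s - 1) B"
  proof -
    have "B = (\<lambda>z. - (1 / c) * (G y z * Fd (monom (- y) s) z))"
    proof
      fix z
      show "B z = - (1 / c) * (G y z * Fd (monom (- y) s) z)"
        using c(1) c(3)[rule_format, of z] by (simp add: field_simps eq_neg_iff_add_eq_0)
    qed
    moreover have "exp_poly_deg (s - 1) (\<lambda>z. - (1 / c) * (G y z * Fd (monom (- y) s) z))"
      using G_deg F_deg by (intro exp_poly_deg_mult exp_poly_deg_const exp_poly_deg_term_deriv) auto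
    ultimately show ?thesis by simp
  qed
  \<comment> \<open>The point \<open>- y\<close> is the element of \<open>W\<close> nearest to 0,
    and \<open>y\<close> is the element of \<open>L\<close> farthest from 0. With w = -t1 l0, y = t0
    l0 and l = r l0 this reads t1 >= t0 >= r, so w + l is a non-negative multiple of -l0.\<close>
  have ray: "\<exists>u. u \<noteq> 0 \<and> (\<forall>w\<in>W. \<forall>l\<in>L. \<exists>t\<ge>0. w + l = complex_of_real t * u)"
  proof (intro exI[of _ "- l0"] conjI ballI)
    fix w l assume w: "w \<in> W" and l: "l \<in> L"
    have l0L: "l0 \<in> L" using l0 by (simp add: L_def)
    obtain t0 where t0: "t0 > 0" "- y = complex_of_real t0 * (- l0)" using opp[OF y(3) l0L] by blast
    obtain t1 where t1: "t1 > 0" "w = complex_of_real t1 * (- l0)" using opp[OF w l0L] by blast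
    obtain t2 where t2: "t2 > 0" "- y = complex_of_real t2 * (- l)" using opp[OF y(3) l] by blast
    define r where "r = t0 / t2"
    have y_eq: "y = complex_of_real t0 * l0" using t0(2) by simp
    have l_eq: "l = complex_of_real r * l0" using t0(2) t2 by (simp add: r_def field_simps)
    have "Re (cnj l0 * (y - l)) \<ge> 0" using y(2) l by (intro cone_le_Re) (auto simp: L_def)
    moreover have "y - l = complex_of_real (t0 - r) * l0" by (simp add: y_eq l_eq algebra_simps)
    ultimately have "(t0 - r) * (cmod l0)\<^sup>2 \<ge> 0" by (simp only: Re_mult)
    then have "t0 \<ge> r" using l0_pos by (simp add: zero_le_mult_iff)
    have "Re (cnj l0 * (- y - w)) \<ge> 0" using W_max[OF w] by (rule cone_le_Re)
    moreover have "- y - w = complex_of_real (t1 - t0) * l0" by (simp add: y_eq t1(2) algebra_simps)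
    ultimately have "(t1 - t0) * (cmod l0)\<^sup>2 \<ge> 0" by (simp only: Re_mult)
    then have "t1 \<ge> t0" using l0_pos by (simp add: zero_le_mult_iff)
    have "w + l = complex_of_real (t1 - r) * (- l0)" by (simp add: t1(2) l_eq algebra_simps)
    then show "\<exists>t\<ge>0. w + l = complex_of_real t * (- l0)" using \<open>t0 \<ge> r\<close> \<open>t1 \<ge> t0\<close> by (intro exI[of _ "t1 - r"]) auto
  qed (use l0 in auto)
  define common where "common = (\<lambda>b. b \<noteq> (0::complex) \<and>
    (\<forall>w\<in>W. \<exists>n::nat. n > 0 \<and> w = of_nat n * b) \<and> (\<forall>l\<in>L. \<exists>n::nat. n > 0 \<and> l = of_nat n * (- b)))"
  have W_comm: "\<exists>b. common b" if comm: "commensurable W"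
  proof -
    obtain b where b: "b \<noteq> 0" "\<forall>w\<in>W. \<exists>n::nat. n > 0 \<and> w = of_nat n * b"
      using comm unfolding commensurable_def by blast
    obtain n :: nat where n: "n > 0" "- y = of_nat n * b" using b(2) y(3) by blast
    have Wint: "\<exists>k. w = of_int k * b" if "w \<in> W" for w
      using b(2) that by (metis of_int_of_nat_eq)
    have "\<exists>n::nat. n > 0 \<and> l = of_nat n * (- b)" if l: "l \<in> L" for l
    proof -
      obtain k where k: "l = of_int k * b"
        using coefficient_frequencies_in_lattice[OF l0 F0_nz _ Wint] y(3) l by (auto simp: L_def)
      obtain t where t: "t > 0" "- y = complex_of_real t * (- l)" using opp[OF y(3) l] by blast
      have "l = complex_of_real (1 / t) * (- (- y))" using t by (simp add: field_simps)
      moreover have "1 / t > 0" using t(1) by simp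
      ultimately show ?thesis by (rule opposite_multiple[OF b(1) k n(2,1)])
    qed
    then show ?thesis using b by (auto simp: common_def)
  qed
  have L_comm: "\<exists>b. common b" if comm: "commensurable L"
  proof -
    obtain b where b: "b \<noteq> 0" "\<forall>l\<in>L. \<exists>n::nat. n > 0 \<and> l = of_nat n * b"
      using comm unfolding commensurable_def by blast
    obtain n :: nat where n: "n > 0" "y = of_nat n * b" using b(2) \<open>y \<in> L\<close> by blast
    \<comment> \<open>\<open>M\<close> may contain 0, which is not in \<open>L\<close> but lies in
      every lattice.\<close>
    have Mint: "\<exists>k. l = of_int k * b" if "l \<in> M" for l
    proof (cases "l = 0")
      case True
      then show ?thesis by (intro exI[of _ 0]) simp
    next
      case False
      then show ?thesis using b(2) that unfolding L_def by (metis DiffI empty_iff insert_iff of_int_of_nat_eq)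
    qed
    have "\<exists>n::nat. n > 0 \<and> w = of_nat n * (- b)" if w: "w \<in> W" for w
    proof -
      obtain k where k: "w = of_int k * b"
        using solution_frequencies_in_lattice[OF l0 Mint w] by blast
      obtain t where t: "t > 0" "w = complex_of_real t * (- y)" using opp[OF w \<open>y \<in> L\<close>] by blast
      show ?thesis by (rule opposite_multiple[OF b(1) k n(2,1) t(2,1)])
    qed
    \<comment> \<open>\<open>common\<close> refers to the factor of \<open>W\<close>, which is the
      negative of the factor of \<open>L\<close>.\<close>
    then have "common (- b)" using b by (auto simp: common_def)
    then show ?thesis by blast
  qed
  have common_W: "commensurable W" and common_L: "commensurable L" if "common b" for b
    using that unfolding common_def commensurable_def by (blast, metis neg_equal_0_iff_equal)
  have "commensurable W \<longrightarrow> strongly_dual_freqs W L"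
    using W_comm dual ray unfolding strongly_dual_freqs_def common_def by blast
  moreover have "commensurable W \<longleftrightarrow> commensurable L" using W_comm L_comm common_W common_L by blast
  ultimately show ?thesis
    using s order_f order_A c(1) f_rep A_rep dual exp_poly_deg_imp_exp_poly[OF B_deg] order_le[OF B_deg]
    by (intro exI[of _ s] conjI exI[of _ c] exI[of _ W] exI[of _ "\<lambda>w. F (monom w s)"] exI[of _ A0]
      exI[of _ L] exI[of _ G]) auto
qed

end
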